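(* Let $G$ be a finite group. If $G$ is integrable, then $G$ has an integral $Q$ with \[ |Q| \leq \left(|\mathrm{Aut}(G)|\,|Z(G)|^{2\mu(G)}\right)^{d(Z(G))+1}. \]
   Context: An integral of a group $G$ is a group $H$ whose commutator (derived) subgroup $[H,H]$ is isomorphic to $G$. A group $G$ is called integrable if it has an integral. $\mathrm{Aut}(G)$ denotes the automorphism group of $G$ and $Z(G)$ its centre. For a finite group $G$, $\mu(G)$ denotes the maximal size of a minimal generating set of $G$, where a minimal generating set is a generating set no proper subset of which generates $G$. For a finite abelian group $A$, $d(A)$ denotes the minimal number of generators of $A$ (so $d$ of the trivial group is $0$). *)

theory Defs
  imports "HOL-Algebra.Algebra"
begin

(* H need not be finite.  HOL cannot quantify over the carrier type of H inside a formula, so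
   "G is integrable" is expressed as a theorem premise "is_integral H G" with H and its type
   arbitrary; a finite integral can always be taken over nat. *)
definition is_integral :: "('h, 'c) monoid_scheme \<Rightarrow> ('a, 'b) monoid_scheme \<Rightarrow> bool" where
  "is_integral H G \<longleftrightarrow> group H \<and> H\<lparr>carrier := derived H (carrier H)\<rparr> \<cong> G"

definition group_center :: "('a, 'b) monoid_scheme \<Rightarrow> ('a, 'b) monoid_scheme" where
  "group_center G =
     G\<lparr>carrier := {z \<in> carrier G. \<forall>g \<in> carrier G. z \<otimes>\<^bsub>G\<^esub> g = g \<otimes>\<^bsub>G\<^esub> z}\<rparr>"

definition generating_set :: "('a, 'b) monoid_scheme \<Rightarrow> 'a set \<Rightarrow> bool" where
  "generating_set G S \<longleftrightarrow> S \<subseteq> carrier G \<and> generate G S = carrier G"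

definition minimal_generating_set :: "('a, 'b) monoid_scheme \<Rightarrow> 'a set \<Rightarrow> bool" where
  "minimal_generating_set G S \<longleftrightarrow>
     generating_set G S \<and> (\<forall>T. T \<subset> S \<longrightarrow> \<not> generating_set G T)"

(* Only meaningful for finite G, where the set of sizes is finite and nonempty. *)
definition max_min_gen :: "('a, 'b) monoid_scheme \<Rightarrow> nat" where
  "max_min_gen G = Max {card S |S. minimal_generating_set G S}"

(* Only meaningful for finitely generated A.  The empty set generates the trivial group,
   whose value is therefore 0. *)
definition min_num_gen :: "('a, 'b) monoid_scheme \<Rightarrow> nat" where
  "min_num_gen A = (LEAST n. \<exists>S. finite S \<and> card S = n \<and> generating_set A S)"

end

theory Submission
  imports Defs
begin

text \<open>
  Let \<open>H\<close> be an integral of the finite group \<open>G\<close>, with \<open>H'\<close> identified with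
  \<open>G\<close>.

  \<^bold>\<open>Making the centre large.\<close> Among the commutators of \<open>H\<close> there is a minimal
  generating set of \<open>G\<close>, so at most \<open>2 * \<mu>(G)\<close> elements of \<open>H\<close> generate a
  subgroup \<open>K\<close> with \<open>K' = H' = G\<close> (\<open>is_integral_few_generators\<close>).  Let
  \<open>A\<close> be the centre of \<open>K\<close>.  Conjugation maps \<open>K\<close> to \<open>Aut(G)\<close> with
  kernel \<open>C\<close>, the centralizer of \<open>G\<close>.  For \<open>c \<in> C\<close> and
  \<open>x \<in> K\<close> the commutator \<open>[x, c]\<close> lies in \<open>Z(G)\<close>, and \<open>c\<close> is
  determined modulo \<open>A\<close> by the values \<open>[x, c]\<close> on the generators \<open>x\<close>.  Hence
  \<open>n = |K : A| \<le> |Aut(G)| |Z(G)|^(2 \<mu>(G))\<close> (\<open>index_center_le\<close>).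

  \<^bold>\<open>Replacing the centre by a small group.\<close> The group \<open>A\<close> may be infinite, and a
  quotient of \<open>K\<close> by a subgroup of \<open>A\<close> that avoids \<open>K'\<close> need not be small
  enough, for instance if \<open>A\<close> is a large cyclic \<open>p\<close>-group meeting \<open>K'\<close>.
  Instead \<open>A\<close> is first pushed into a divisible group.  Put \<open>d = d(Z(G))\<close> and let
  \<open>D\<close> be the direct product of \<open>d\<close> copies of the multiplicative group of the complex
  numbers.  The finite group \<open>A \<inter> K'\<close> embeds in \<open>Z(G)\<close>, so for each prime
  \<open>p\<close> it has at most \<open>p^d\<close> elements of exponent dividing \<open>p\<close>; therefore
  \<open>d\<close> complex characters suffice to separate its points (\<open>separating_characters\<close>).  As the
  multiplicative group of the complex numbers is divisible, these characters extend to \<open>A\<close>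
  (\<open>character_extends\<close>) and give \<open>\<phi> : A \<rightarrow> D\<close>, injective on
  \<open>A \<inter> K'\<close>.  The transfer from \<open>K\<close> to its central subgroup \<open>A\<close> restricts
  to the \<open>n\<close>-th power map on \<open>A\<close>, so \<open>\<phi>^n\<close> extends to a homomorphism
  \<open>T : K \<rightarrow> D\<close> (\<open>transfer_character\<close>).  Now let
  \<open>P = {(g, e) \<in> K \<times> D. e^n = T g}\<close> and let \<open>N = {(a, \<phi> a). a \<in> A}\<close>, a
  central subgroup of \<open>P\<close>.  Then \<open>Q = P / N\<close> has order at most \<open>n * n^d\<close>:
  modulo \<open>N\<close> only a transversal of \<open>A\<close> is needed for \<open>g\<close>, and \<open>e\<close>
  is determined by \<open>g\<close> up to the \<open>n^d\<close> elements of \<open>D\<close> of exponent dividing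
  \<open>n\<close>.  Since \<open>D\<close> is abelian, \<open>P' = K' \<times> 1\<close>, which meets
  \<open>N\<close> trivially because \<open>\<phi>\<close> is injective on \<open>A \<inter> K'\<close>; so
  \<open>Q' \<cong> K' \<cong> G\<close> (\<open>quotient_with_same_derived_subgroup\<close>).
\<close>

section \<open>Extending complex characters of abelian groups\<close>

definition complex_units :: "complex monoid" where
  "complex_units = \<lparr>carrier = UNIV - {0}, monoid.mult = (*), one = 1\<rparr>"

lemma complex_units_simps [simp]:
  "carrier complex_units = UNIV - {0}"
  "x \<otimes>\<^bsub>complex_units\<^esub> y = x * y"
  "\<one>\<^bsub>complex_units\<^esub> = 1"
  by (simp_all add: complex_units_def)

lemma comm_group_complex_units: "comm_group complex_units"
  by (rule comm_groupI) (auto intro!: bexI[of _ "inverse _"])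

interpretation complex_units: comm_group complex_units
  by (rule comm_group_complex_units)

lemma complex_units_inv [simp]: "z \<noteq> 0 \<Longrightarrow> inv\<^bsub>complex_units\<^esub> z = inverse z"
  by (rule complex_units.inv_equality) auto

lemma complex_units_nat_pow [simp]: "z [^]\<^bsub>complex_units\<^esub> (n::nat) = z ^ n"
  by (induction n) auto

lemma complex_units_int_pow [simp]: "z \<noteq> 0 \<Longrightarrow> z [^]\<^bsub>complex_units\<^esub> (k::int) = z powi k"
  by (simp add: int_pow_def2 power_int_def power_inverse)

lemma DirProd_int_pow:
  assumes "group G" "group H" "x \<in> carrier G" "y \<in> carrier H"
  shows "(x, y) [^]\<^bsub>G \<times>\<times> H\<^esub> (k::int) = (x [^]\<^bsub>G\<^esub> k, y [^]\<^bsub>H\<^esub> k)"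
proof -
  have "fst \<in> hom (G \<times>\<times> H) G" "snd \<in> hom (G \<times>\<times> H) H"
    by (auto simp: hom_def mult_DirProd')
  then show ?thesis
    using assms by (simp add: prod_eq_iff hom_int_pow DirProd_group)
qed

lemma exists_complex_root:
  fixes w :: complex
  assumes "w \<noteq> 0" "n > 0"
  obtains z where "z \<noteq> 0" "z ^ n = w"
proof -
  have "card {z::complex. z ^ n = w} = n"
    using assms by (intro card_nth_roots) auto
  then obtain z where "z ^ n = w"
    using assms by (metis (mono_tags, lifting) Collect_empty_eq card.empty less_not_refl)
  then show thesis using that assms by (metis power_0_left gr_implies_not0)
qed

lemma (in comm_group) comm_group_DirProd_units: "comm_group (G \<times>\<times> complex_units)"
  by (rule group.group_comm_groupI)
     (auto simp: DirProd_group m_comm)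

text \<open>
  The one-step extension of a character.  A partial character is represented by its graph \<open>R\<close>, a subgroup
  of the product with the multiplicative group of the complex numbers.  If some positive power of \<open>a\<close>
  already lies in the domain, take the least such exponent \<open>m\<close>; all other exponents in question are
  multiples of \<open>m\<close>, so any \<open>m\<close>-th root of the value at \<open>a^m\<close> is a consistent
  value at \<open>a\<close>.  Otherwise there is no constraint.
\<close>
lemma (in comm_group) partial_character_compatible_value:
  assumes R: "subgroup R (G \<times>\<times> complex_units)" "\<And>z. (\<one>, z) \<in> R \<Longrightarrow> z = 1"
    and a: "a \<in> carrier G"
  obtains z where "z \<noteq> 0" "\<And>k w. (a [^] (k::int), w) \<in> R \<Longrightarrow> w = z powi k"
proof (cases "\<exists>m>0. \<exists>w. (a [^] (m::nat), w) \<in> R")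
  case True
  interpret E: comm_group "G \<times>\<times> complex_units" by (rule comm_group_DirProd_units)
  interpret R: subgroup R "G \<times>\<times> complex_units" by fact
  define m where "m = (LEAST m::nat. m > 0 \<and> (\<exists>w. (a [^] m, w) \<in> R))"
  have "m > 0 \<and> (\<exists>w. (a [^] m, w) \<in> R)"
    unfolding m_def using LeastI_ex[of "\<lambda>m. m > 0 \<and> (\<exists>w. (a [^] (m::nat), w) \<in> R)"] True by blast
  then obtain w where m: "m > 0" "(a [^] m, w) \<in> R" by blast
  have least: "m \<le> j" if "j > 0" "(a [^] j, v) \<in> R" for j :: nat and v
    unfolding m_def by (rule Least_le) (use that in blast)
  have nz: "v \<noteq> 0" if "(x, v) \<in> R" for x v
    using R.subset that by auto
  obtain z where z: "z \<noteq> 0" "z ^ m = w"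
    using exists_complex_root nz m by blast
  have "v = z powi k" if v: "(a [^] k, v) \<in> R" for k :: int and v
  proof -
    define q where "q = k div int m"
    define r where "r = nat (k mod int m)"
    have k: "k = int r + int m * q" unfolding q_def r_def using m by simp
    have "(a [^] (int m), w) [^]\<^bsub>G \<times>\<times> complex_units\<^esub> (-q) \<in> R"
      using m by (intro E.subgroup_int_pow_closed R) (simp add: int_pow_int)
    then have "(a [^] (- (int m * q)), w powi (-q)) \<in> R"
      using a m nz by (simp add: DirProd_int_pow int_pow_pow)
    then have "(a [^] k, v) \<otimes>\<^bsub>G \<times>\<times> complex_units\<^esub> (a [^] (- (int m * q)), w powi (-q)) \<in> R"
      using v by blast
    then have "(a [^] (int r), v * w powi (-q)) \<in> R"
      using a by (simp add: k flip: int_pow_mult)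
    then have rR: "(a [^] r, v * w powi (-q)) \<in> R" by (simp add: int_pow_int)
    have "r < m" unfolding r_def using m by (simp add: nat_less_iff)
    then have r: "r = 0" using least rR by (metis gr0I leD)
    then have "v * w powi (-q) = 1" using rR R(2) by simp
    then have "v = w powi q" using nz[OF m(2)] by (simp add: power_int_minus field_simps)
    also have "\<dots> = z powi (int m * q)" by (simp add: z(2)[symmetric] power_int_mult)
    finally show ?thesis using k r by simp
  qed
  with z show thesis using that by blast
next
  case False
  interpret E: comm_group "G \<times>\<times> complex_units" by (rule comm_group_DirProd_units)
  have "w = 1 powi k" if w: "(a [^] k, w) \<in> R" for k :: int and w
  proof -
    have "k = 0"
    proof (rule ccontr)
      assume "k \<noteq> 0"
      have wz: "w \<noteq> 0" using w subgroup.subset[OF R(1)] by auto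
      have "(a [^] k, w) [^]\<^bsub>G \<times>\<times> complex_units\<^esub> sgn k \<in> R"
        by (intro E.subgroup_int_pow_closed R w)
      then have "(a [^] \<bar>k\<bar>, w powi sgn k) \<in> R"
        using a wz by (simp add: DirProd_int_pow int_pow_pow abs_sgn)
      then have "(a [^] (nat \<bar>k\<bar>), w powi sgn k) \<in> R"
        by (simp add: pow_nat)
      then show False using False \<open>k \<noteq> 0\<close> by (metis zero_less_abs_iff zero_less_nat_eq)
    qed
    then show ?thesis using w R(2) by simp
  qed
  then show thesis using that[of 1] by auto
qed

text \<open>
  Zorn's lemma on the graphs of partial characters.  A subgroup \<open>R\<close> of
  \<open>G \<times> complex_units\<close> is the graph of a function exactly when \<open>1\<close> is the only value
  that it relates to the identity, and this condition passes to unions of chains.  A maximal graph is defined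
  everywhere, since it could otherwise be extended by one more element.
\<close>
lemma (in comm_group) character_extends:
  assumes S: "subgroup S G" and chi: "\<chi> \<in> hom (G\<lparr>carrier := S\<rparr>) complex_units"
  obtains \<psi> where "\<psi> \<in> hom G complex_units" "\<And>x. x \<in> S \<Longrightarrow> \<psi> x = \<chi> x"
proof -
  let ?E = "G \<times>\<times> complex_units"
  interpret E: comm_group ?E by (rule comm_group_DirProd_units)
  interpret S: subgroup S G by fact
  interpret \<chi>: group_hom "G\<lparr>carrier := S\<rparr>" complex_units \<chi>
    using chi S by (simp add: group_hom_def group_hom_axioms_def subgroup.subgroup_is_group is_group)
  define \<A> where "\<A> = {R. subgroup R ?E \<and> (\<lambda>x. (x, \<chi> x)) ` S \<subseteq> R \<and> (\<forall>z. (\<one>, z) \<in> R \<longrightarrow> z = 1)}"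
  have graph: "(\<lambda>x. (x, \<chi> x)) ` S \<in> \<A>"
  proof -
    have "(\<lambda>x. (x, \<chi> x)) \<in> hom (G\<lparr>carrier := S\<rparr>) ?E"
      using chi S.subset by (auto simp: hom_def Pi_iff)
    then interpret g: group_hom "G\<lparr>carrier := S\<rparr>" ?E "\<lambda>x. (x, \<chi> x)"
      by (simp add: group_hom_def group_hom_axioms_def \<chi>.G.is_group E.is_group)
    show ?thesis
      using g.img_is_subgroup \<chi>.hom_one by (auto simp: \<A>_def)
  qed
  have "\<exists>M\<in>\<A>. \<forall>R\<in>\<A>. M \<subseteq> R \<longrightarrow> R = M"
  proof (rule subset_Zorn_nonempty)
    show "\<A> \<noteq> {}" using graph by blast
  next
    fix \<C> assume ne: "\<C> \<noteq> {}" and chain: "subset.chain \<A> \<C>"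
    have sub: "\<And>R. R \<in> \<C> \<Longrightarrow> R \<in> \<A>" using chain by (auto simp: subset.chain_def)
    have "subgroup (\<Union>\<C>) ?E"
    proof (rule E.subgroupI)
      show "\<Union>\<C> \<subseteq> carrier ?E" using sub subgroup.subset unfolding \<A>_def by blast
      show "\<Union>\<C> \<noteq> {}" using ne sub subgroup.one_closed unfolding \<A>_def by blast
      show "inv\<^bsub>?E\<^esub> x \<in> \<Union>\<C>" if "x \<in> \<Union>\<C>" for x
        using that sub unfolding \<A>_def by (blast dest: subgroup.m_inv_closed)
      show "x \<otimes>\<^bsub>?E\<^esub> y \<in> \<Union>\<C>" if xy: "x \<in> \<Union>\<C>" "y \<in> \<Union>\<C>" for x y
      proof -
        obtain R R' where "R \<in> \<C>" "x \<in> R" "R' \<in> \<C>" "y \<in> R'" using xy by blast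
        moreover have "R \<subseteq> R' \<or> R' \<subseteq> R" using chain calculation by (auto simp: subset.chain_def)
        ultimately obtain Z where "Z \<in> \<C>" "x \<in> Z" "y \<in> Z" by blast
        then show ?thesis using sub unfolding \<A>_def by (blast dest: subgroup.m_closed)
      qed
    qed
    then show "\<Union>\<C> \<in> \<A>" using ne sub unfolding \<A>_def by blast
  qed
  then obtain M where M: "M \<in> \<A>" and max: "\<And>R. R \<in> \<A> \<Longrightarrow> M \<subseteq> R \<Longrightarrow> R = M" by blast
  have Msub: "subgroup M ?E" and Mone: "\<And>z. (\<one>, z) \<in> M \<Longrightarrow> z = 1" using M by (auto simp: \<A>_def)
  interpret M: subgroup M ?E by fact
  have total: "\<exists>z. (a, z) \<in> M" if a: "a \<in> carrier G" for a
  proof -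
    obtain z where z: "z \<noteq> 0" "\<And>k w. (a [^] (k::int), w) \<in> M \<Longrightarrow> w = z powi k"
      using partial_character_compatible_value[OF Msub Mone a] by blast
    let ?L = "range (\<lambda>k::int. (a, z) [^]\<^bsub>?E\<^esub> k)"
    have L: "subgroup ?L ?E" using a z by (intro E.subgroup_of_powers) auto
    have M_le: "M \<subseteq> M <#>\<^bsub>?E\<^esub> ?L"
    proof
      fix x assume x: "x \<in> M"
      then have "x = x \<otimes>\<^bsub>?E\<^esub> \<one>\<^bsub>?E\<^esub>" using M.subset by (intro E.r_one[symmetric]) auto
      then show "x \<in> M <#>\<^bsub>?E\<^esub> ?L"
        using x subgroup.one_closed[OF L] unfolding set_mult_def by blast
    qed
    have "M <#>\<^bsub>?E\<^esub> ?L \<in> \<A>"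
    proof -
      have "v = 1" if v: "(\<one>, v) \<in> M <#>\<^bsub>?E\<^esub> ?L" for v
      proof -
        obtain s w and k :: int where sw: "(s, w) \<in> M" "(\<one>, v) = (s, w) \<otimes>\<^bsub>?E\<^esub> (a, z) [^]\<^bsub>?E\<^esub> k"
          using v by (auto simp: set_mult_def)
        have s: "s \<in> carrier G" using sw M.subset by auto
        have e: "\<one> = s \<otimes> a [^] k" "v = w * z powi k"
          using sw a z by (auto simp: DirProd_int_pow)
        have "s = a [^] (-k)" using e s a by (metis int_pow_neg int_pow_closed inv_equality inv_inv inv_closed)
        then have "w = z powi (-k)" using z sw by blast
        then show ?thesis using e z by (simp add: power_int_minus)
      qed
      moreover have "(\<lambda>x. (x, \<chi> x)) ` S \<subseteq> M <#>\<^bsub>?E\<^esub> ?L" using M_le M unfolding \<A>_def by blast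
      ultimately show ?thesis using E.mult_subgroups[OF Msub L] unfolding \<A>_def by blast
    qed
    then have eq: "M <#>\<^bsub>?E\<^esub> ?L = M" using max M_le by blast
    have "(a, z) = (a, z) [^]\<^bsub>?E\<^esub> (1::int)" using a z by (intro E.int_pow_1[symmetric]) auto
    then have "(a, z) = \<one>\<^bsub>?E\<^esub> \<otimes>\<^bsub>?E\<^esub> (a, z) [^]\<^bsub>?E\<^esub> (1::int)" using a z by simp
    then have "(a, z) \<in> M <#>\<^bsub>?E\<^esub> ?L" using M.one_closed unfolding set_mult_def by blast
    then show ?thesis using eq by blast
  qed
  have unique: "v = w" if "(a, v) \<in> M" "(a, w) \<in> M" for a v w
  proof -
    have nz: "a \<in> carrier G" "v \<noteq> 0" "w \<noteq> 0" using that M.subset by auto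
    have "(a, v) \<otimes>\<^bsub>?E\<^esub> inv\<^bsub>?E\<^esub> (a, w) \<in> M" using that by blast
    then have "(\<one>, v / w) \<in> M" using nz by (simp add: field_simps)
    then show ?thesis using Mone nz by fastforce
  qed
  define \<psi> where "\<psi> a = (THE z. (a, z) \<in> M)" for a
  have \<psi>: "\<psi> a = z" if "(a, z) \<in> M" for a z
    unfolding \<psi>_def using unique that by blast
  have \<psi>M: "(a, \<psi> a) \<in> M" if "a \<in> carrier G" for a
    using total[OF that] \<psi> by blast
  show thesis
  proof (rule that[of \<psi>])
    show "\<psi> \<in> hom G complex_units"
    proof (rule homI)
      show "\<psi> x \<in> carrier complex_units" if "x \<in> carrier G" for x
        using \<psi>M[OF that] M.subset by auto
      show "\<psi> (x \<otimes> y) = \<psi> x \<otimes>\<^bsub>complex_units\<^esub> \<psi> y" if "x \<in> carrier G" "y \<in> carrier G" for x y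
        using M.m_closed[OF \<psi>M[OF that(1)] \<psi>M[OF that(2)]] \<psi> by simp
    qed
    show "\<psi> x = \<chi> x" if "x \<in> S" for x
      using M that \<psi> unfolding \<A>_def by blast
  qed
qed

section \<open>Separating the points of a finite abelian group by few characters\<close>

lemma (in comm_group) card_generate_insert_le:
  fixes p :: nat
  assumes L: "subgroup L G" "finite L" and s: "s \<in> carrier G" "s [^] p \<in> L" and p: "p > 0"
  shows "finite (generate G (insert s L))" "card (generate G (insert s L)) \<le> p * card L"
proof -
  interpret L: subgroup L G by fact
  let ?C = "range (\<lambda>k::int. s [^] k)"
  have C: "subgroup ?C G" using s by (intro subgroup_of_powers)
  have "insert s L \<subseteq> L <#> ?C"
  proof -
    have "s = \<one> \<otimes> s [^] (1::int)" using s by simp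
    then have "s \<in> L <#> ?C" using L.one_closed unfolding set_mult_def by blast
    moreover have "y \<in> L <#> ?C" if y: "y \<in> L" for y
    proof -
      have "y = y \<otimes> s [^] (0::int)" using y L.subset by auto
      then show ?thesis using y unfolding set_mult_def by blast
    qed
    ultimately show ?thesis by blast
  qed
  then have 1: "generate G (insert s L) \<subseteq> L <#> ?C"
    by (rule generate_subgroup_incl) (rule mult_subgroups[OF L(1) C])
  have 2: "L <#> ?C \<subseteq> (\<lambda>(y, i). y \<otimes> s [^] i) ` (L \<times> {..<p})"
  proof
    fix x assume "x \<in> L <#> ?C"
    then obtain y and k :: int where x: "y \<in> L" "x = y \<otimes> s [^] k" by (auto simp: set_mult_def)
    define r where "r = nat (k mod int p)"
    have k: "k = int p * (k div int p) + int r" using p by (simp add: r_def)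
    have r: "r < p" using p by (simp add: r_def nat_less_iff)
    have "s [^] k = (s [^] p) [^] (k div int p) \<otimes> s [^] r"
      using s by (subst k) (simp add: int_pow_mult int_pow_pow flip: int_pow_int)
    moreover have "(s [^] p) [^] (k div int p) \<in> L" using s L by (intro subgroup_int_pow_closed)
    ultimately have "x = (y \<otimes> (s [^] p) [^] (k div int p)) \<otimes> s [^] r"
      "y \<otimes> (s [^] p) [^] (k div int p) \<in> L"
      using x s L.subset by (auto simp: m_assoc subsetD)
    then show "x \<in> (\<lambda>(y, i). y \<otimes> s [^] i) ` (L \<times> {..<p})" using r by force
  qed
  have fin: "finite ((\<lambda>(y, i). y \<otimes> s [^] i) ` (L \<times> {..<p}))" using L by simp
  show "finite (generate G (insert s L))" using finite_subset[OF subset_trans[OF 1 2] fin] .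
  have "card (generate G (insert s L)) \<le> card ((\<lambda>(y, i). y \<otimes> s [^] i) ` (L \<times> {..<p}))"
    by (rule card_mono[OF fin subset_trans[OF 1 2]])
  also have "\<dots> \<le> card (L \<times> {..<p})" using L by (intro card_image_le) simp
  finally show "card (generate G (insert s L)) \<le> p * card L" by (simp add: card_cartesian_product mult.commute)
qed

lemma (in comm_group) card_generate_union_powers_le:
  fixes p :: nat
  assumes P: "subgroup P G" "finite P" and p: "p > 0" "\<And>x. x \<in> carrier G \<Longrightarrow> x [^] p \<in> P"
    and S: "finite S" "S \<subseteq> carrier G"
  shows "finite (generate G (S \<union> P)) \<and> card (generate G (S \<union> P)) \<le> p ^ card S * card P"
  using S
proof (induction S)
  case empty
  have "generate G P = P" using generateI[OF P(1), of P] by auto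
  then show ?case using P by simp
next
  case (insert s S)
  let ?L = "generate G (S \<union> P)"
  have sub: "S \<union> P \<subseteq> carrier G" using insert subgroup.subset[OF P(1)] by auto
  have L: "subgroup ?L G" by (rule generate_is_subgroup[OF sub])
  have PL: "P \<subseteq> ?L" "S \<subseteq> ?L" by (auto intro: generate.incl)
  have sp: "s \<in> carrier G" "s [^] p \<in> ?L" using insert p PL by auto
  have le: "finite (generate G (insert s ?L))" "card (generate G (insert s ?L)) \<le> p * card ?L"
    by (rule card_generate_insert_le[OF L _ sp p(1)]; use insert in simp)+
  have eq: "generate G (insert s S \<union> P) \<subseteq> generate G (insert s ?L)"
    using PL by (intro mono_generate) auto
  have "card (generate G (insert s S \<union> P)) \<le> card (generate G (insert s ?L))"
    by (rule card_mono[OF le(1) eq])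
  also have "\<dots> \<le> p * card ?L" by (rule le(2))
  also have "\<dots> \<le> p * (p ^ card S * card P)" using insert by simp
  finally show ?case using insert.hyps finite_subset[OF eq le(1)] by simp
qed

text \<open>
  The elements of exponent dividing \<open>p\<close> are the kernel of the \<open>p\<close>-th power map, so their
  number is the index of its image \<open>P\<close>.  The quotient by \<open>P\<close> has exponent dividing \<open>p\<close>
  and is generated by the image of \<open>S\<close>, so this index is at most \<open>p ^ card S\<close>.
\<close>
lemma (in comm_group) card_torsion_le:
  fixes p :: nat
  assumes fin: "finite (carrier G)" and S: "generating_set G S" and p: "p > 0"
  shows "card {x \<in> carrier G. x [^] p = \<one>} \<le> p ^ card S"
proof -
  let ?T = "{x \<in> carrier G. x [^] p = \<one>}" and ?P = "(\<lambda>x. x [^] p) ` carrier G"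
  have hom: "(\<lambda>x. x [^] p) \<in> hom G G" by (auto simp: hom_def nat_pow_distrib)
  have P: "subgroup ?P G"
    using group_hom.img_is_subgroup[of G G "\<lambda>x. x [^] p"] hom
    by (simp add: group_hom_def group_hom_axioms_def)
  define r where "r = inv_into (carrier G) (\<lambda>x. x [^] p)"
  have r: "r y \<in> carrier G" "r y [^] p = y" if "y \<in> ?P" for y
    using that unfolding r_def by (auto intro: inv_into_into f_inv_into_f)
  have "inj_on (\<lambda>(t, y). t \<otimes> r y) (?T \<times> ?P)"
  proof (rule inj_onI, clarify)
    fix t u x y
    assume *: "t \<in> carrier G" "t [^] p = \<one>" "u \<in> carrier G" "u [^] p = \<one>" "x \<in> carrier G" "y \<in> carrier G"
      "t \<otimes> r (x [^] p) = u \<otimes> r (y [^] p)"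
    have "(t \<otimes> r (x [^] p)) [^] p = x [^] p" "(u \<otimes> r (y [^] p)) [^] p = y [^] p"
      using *(1-6) r by (simp_all add: nat_pow_distrib)
    then have eq: "x [^] p = y [^] p" using *(7) by metis
    then have "t \<otimes> r (y [^] p) = u \<otimes> r (y [^] p)" using *(7) by simp
    then show "t = u \<and> x [^] p = y [^] p" using *(1,3,6) r(1)[of "y [^] p"] eq by simp
  qed
  moreover have "(\<lambda>(t, y). t \<otimes> r y) ` (?T \<times> ?P) \<subseteq> carrier G" using r by auto
  ultimately have "card (?T \<times> ?P) \<le> card (carrier G)" using card_inj_on_le fin by blast
  moreover have "card (carrier G) \<le> p ^ card S * card ?P"
  proof -
    have S': "S \<subseteq> carrier G" "generate G S = carrier G" using S by (auto simp: generating_set_def)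
    have "carrier G \<subseteq> generate G (S \<union> ?P)" using S' mono_generate[of S "S \<union> ?P"] by simp
    then have eq: "generate G (S \<union> ?P) = carrier G"
      using generate_incl[of "S \<union> ?P"] S' by auto
    have "finite S" using S' fin finite_subset by blast
    then show ?thesis
      using card_generate_union_powers_le[OF P _ p, of S] S' fin unfolding eq by auto
  qed
  ultimately have "card ?T * card ?P \<le> p ^ card S * card ?P"
    unfolding card_cartesian_product by (rule order_trans)
  moreover have "card ?P > 0" using fin by (simp add: card_gt_0_iff) blast
  ultimately show ?thesis by simp
qed

text \<open>
  Send \<open>z\<close> to a primitive root of unity of order \<open>ord z\<close>, and extend this faithful character
  of the cyclic group generated by \<open>z\<close>.
\<close>
lemma (in comm_group) exists_faithful_character:
  assumes z: "z \<in> carrier G" "ord z > 0"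
  obtains \<chi> where "\<chi> \<in> hom G complex_units" "\<And>k::nat. \<chi> (z [^] k) = 1 \<Longrightarrow> z [^] k = \<one>"
proof -
  let ?S = "range (\<lambda>k::int. z [^] k)" and ?m = "ord z"
  define \<omega> where "\<omega> = cis (2 * pi / ?m)"
  have \<omega>pow: "\<omega> ^ ?m = 1" "\<omega> \<noteq> 0"
    using z by (auto simp: \<omega>_def DeMoivre)
  have \<omega>: "\<omega> powi k = 1" if k: "int ?m dvd k" for k
  proof -
    obtain j where "k = int ?m * j" using k by blast
    then show ?thesis using \<omega>pow by (simp add: power_int_mult)
  qed
  have \<omega>nat: "?m dvd k" if k: "\<omega> ^ k = 1" for k :: nat
  proof -
    have inj: "inj_on (\<lambda>k. cis (2 * pi * real k / real ?m)) {..<?m}"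
      using bij_betw_roots_unity[OF z(2)] by (simp add: bij_betw_def)
    have "\<omega> ^ k = \<omega> ^ (k mod ?m)"
      by (metis \<omega>pow(1) mult.right_neutral mod_mult_div_eq power_add power_mult power_one)
    then have "cis (2 * pi * real (k mod ?m) / real ?m) = cis (2 * pi * real 0 / real ?m)"
      using k by (simp add: \<omega>_def DeMoivre mult_ac)
    then have "k mod ?m = 0" using inj_onD[OF inj] z by simp
    then show ?thesis by auto
  qed
  define e where "e x = (SOME k::int. x = z [^] k)" for x
  have e: "int ?m dvd k - e (z [^] k)" for k :: int
  proof -
    have "z [^] k = z [^] e (z [^] k)" unfolding e_def by (rule someI_ex) auto
    then show ?thesis using int_pow_eq[OF z(1)] by (metis)
  qed
  have val: "\<omega> powi e (z [^] k) = \<omega> powi k" for k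
  proof -
    have "\<omega> powi k = \<omega> powi (k - e (z [^] k)) * \<omega> powi e (z [^] k)"
      using \<omega>pow by (simp flip: power_int_add)
    then show ?thesis using \<omega>[OF e] by simp
  qed
  have "(\<lambda>x. \<omega> powi e x) \<in> hom (G\<lparr>carrier := ?S\<rparr>) complex_units"
  proof (rule homI)
    fix x y assume "x \<in> carrier (G\<lparr>carrier := ?S\<rparr>)" "y \<in> carrier (G\<lparr>carrier := ?S\<rparr>)"
    then obtain k l :: int where "x = z [^] k" "y = z [^] l" by auto
    then show "\<omega> powi e (x \<otimes>\<^bsub>G\<lparr>carrier := ?S\<rparr>\<^esub> y) = \<omega> powi e x \<otimes>\<^bsub>complex_units\<^esub> \<omega> powi e y"
      using z \<omega>pow by (simp add: val power_int_add flip: int_pow_mult)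
  qed (use \<omega>pow in auto)
  from character_extends[OF subgroup_of_powers[OF z(1)] this]
  obtain \<psi> where \<psi>: "\<psi> \<in> hom G complex_units" "\<And>x. x \<in> ?S \<Longrightarrow> \<psi> x = \<omega> powi e x" by blast
  show thesis
  proof (rule that[OF \<psi>(1)])
    fix k :: nat
    assume "\<psi> (z [^] k) = 1"
    moreover have "\<psi> (z [^] k) = \<omega> ^ k"
      using \<psi>(2)[OF rangeI[of _ "int k"]] val[of "int k"] by (simp add: int_pow_int)
    ultimately show "z [^] k = \<one>" using \<omega>nat pow_eq_id[OF z(1)] by simp
  qed
qed

lemma (in group) exists_prime_order_power:
  assumes x: "x \<in> carrier G" "x \<noteq> \<one>" "ord x > 0"
  obtains p k :: nat where "Factorial_Ring.prime p" "(x [^] k) [^] p = \<one>" "x [^] k \<noteq> \<one>"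
proof -
  have "ord x \<noteq> 1" using x ord_eq_1 by blast
  then obtain p :: nat where p: "Factorial_Ring.prime p" "p dvd ord x"
    using prime_factor_nat by blast
  then obtain k where k: "ord x = k * p" by (metis dvdE mult.commute)
  have "\<not> ord x dvd k"
    using x(3) prime_gt_1_nat[OF p(1)] by (auto simp: k dest: dvd_imp_le)
  then have "x [^] k \<noteq> \<one>" using x pow_eq_id by simp
  moreover have "(x [^] k) [^] p = \<one>"
    using x(1) pow_ord_eq_1[OF x(1)] by (simp add: nat_pow_pow k)
  ultimately show thesis using that p(1) by blast
qed

lemma (in group) ord_pos_of_finite_subgroup:
  assumes K: "subgroup K G" "finite K" and x: "x \<in> K"
  shows "ord x > 0"
proof -
  have "generate G {x} \<subseteq> K" using x K by (intro generate_subgroup_incl) auto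
  then have "finite (generate G {x})" using K finite_subset by blast
  moreover have "generate G {x} \<noteq> {}" using generate.one by fast
  ultimately have "card (generate G {x}) > 0" by (simp add: card_gt_0_iff)
  then show ?thesis using generate_pow_card[OF subgroup.mem_carrier[OF K(1) x]] by simp
qed

text \<open>
  An element \<open>z\<close> of maximal order works: if \<open>u\<close> had prime order not dividing that of
  \<open>z\<close>, then \<open>z \<otimes> u\<close> would have the larger order \<open>ord z * ord u\<close>.
\<close>
lemma (in comm_group) exists_element_all_prime_orders:
  assumes K: "subgroup K G" "finite K"
  obtains z where "z \<in> K" "ord z > 0"
    "\<And>u. u \<in> K \<Longrightarrow> Factorial_Ring.prime (ord u) \<Longrightarrow> ord u dvd ord z"
proof -
  interpret K: subgroup K G by fact
  have fin: "ord x > 0" if "x \<in> K" for x by (rule ord_pos_of_finite_subgroup[OF K that])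
  have ne: "K \<noteq> {}" using K.one_closed by blast
  then have "Max (ord ` K) \<in> ord ` K" using K by (intro Max_in) auto
  then obtain z where zK: "z \<in> K" "Max (ord ` K) = ord z" by blast
  have z: "z \<in> K" "\<And>x. x \<in> K \<Longrightarrow> ord x \<le> ord z"
    using zK K by (simp_all flip: zK(2))
  have "p dvd ord z" if p: "Factorial_Ring.prime p" and u: "u \<in> K" "ord u = p" for p u
  proof (rule ccontr)
    assume "\<not> p dvd ord z"
    then have cop: "coprime (ord z) p" using p by (metis coprime_commute prime_imp_coprime)
    define n where "n = ord (z \<otimes> u)"
    have c: "z \<in> carrier G" "u \<in> carrier G" using z u K.subset by auto
    have "\<one> = ((z \<otimes> u) [^] n) [^] p" using c by (simp add: n_def)
    also have "\<dots> = z [^] (n * p)"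
      using c u(2) by (simp add: nat_pow_pow nat_pow_distrib pow_eq_id[THEN iffD2])
    finally have "ord z dvd n * p" using pow_eq_id c by metis
    then have zn: "ord z dvd n" using cop by (simp add: coprime_dvd_mult_left_iff)
    have "z [^] n \<otimes> u [^] n = \<one>" using c by (simp add: n_def flip: nat_pow_distrib)
    then have "u [^] n = \<one>" using zn c pow_eq_id[of z n] by simp
    then have "p dvd n" using pow_eq_id[of u n] c u by simp
    then have "ord z * p dvd n" using zn cop by (simp add: divides_mult)
    moreover have zu: "z \<otimes> u \<in> K" using z u by blast
    then have "n > 0" "n \<le> ord z" using fin z unfolding n_def by blast+
    ultimately have "ord z * p \<le> ord z" by (meson dvd_imp_le le_trans)
    then show False using fin[OF z(1)] prime_gt_1_nat[OF p] by simp
  qed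
  then show thesis using that[OF z(1) fin[OF z(1)]] by simp
qed

text \<open>
  Induction on \<open>d\<close>.  Choose \<open>z \<in> K\<close> whose order is divisible by every prime that is the
  order of an element of \<open>K\<close>, and a character \<open>\<chi>\<close> that is faithful on the powers of
  \<open>z\<close>.  For every such prime \<open>p\<close>, a power \<open>u\<close> of \<open>z\<close> has order
  \<open>p\<close>, and the powers of \<open>u\<close> meet the kernel of \<open>\<chi>\<close> trivially; so passing
  from \<open>K\<close> to the kernel of \<open>\<chi>\<close> on \<open>K\<close> divides the number of elements of
  exponent dividing \<open>p\<close> by at least \<open>p\<close>.  For any other prime \<open>p\<close> the identity
  is the only such element.  The remaining \<open>d\<close> characters come from the kernel.
\<close>
lemma (in comm_group) separating_characters:
  assumes "subgroup K G" "finite K"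
    and "\<And>p::nat. Factorial_Ring.prime p \<Longrightarrow> card {x \<in> K. x [^] p = \<one>} \<le> p ^ d"
  shows "\<exists>\<chi>. (\<forall>i<d. \<chi> i \<in> hom G complex_units) \<and> (\<forall>x\<in>K. (\<forall>i<d. \<chi> i x = 1) \<longrightarrow> x = \<one>)"
  using assms
proof (induction d arbitrary: K)
  case 0
  interpret K: subgroup K G by fact
  have "x = \<one>" if x: "x \<in> K" for x
  proof (rule ccontr)
    assume "x \<noteq> \<one>"
    moreover have "ord x > 0" by (rule ord_pos_of_finite_subgroup[OF 0(1,2) x])
    ultimately obtain p k :: nat where p: "Factorial_Ring.prime p" "(x [^] k) [^] p = \<one>" "x [^] k \<noteq> \<one>"
      using exists_prime_order_power[of x] x K.subset by blast
    have "x [^] k \<in> K" using x subgroup_int_pow_closed[OF 0(1), of x "int k"] by (simp add: int_pow_int)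
    then have "{\<one>, x [^] k} \<subseteq> {x \<in> K. x [^] p = \<one>}" using p by auto
    then have "card {\<one>, x [^] k} \<le> card {x \<in> K. x [^] p = \<one>}" using 0(2) by (intro card_mono) auto
    then have "card {\<one>, x [^] k} \<le> 1" using 0(3)[OF p(1)] by simp
    then show False using p by simp
  qed
  then show ?case by auto
next
  case (Suc d)
  interpret K: subgroup K G by fact
  have powK: "x [^] k \<in> K" if "x \<in> K" for x and k :: nat
    using that subgroup_int_pow_closed[OF Suc.prems(1), of x "int k"] by (simp add: int_pow_int)
  obtain z where z: "z \<in> K" "ord z > 0"
    and zp: "\<And>u. u \<in> K \<Longrightarrow> Factorial_Ring.prime (ord u) \<Longrightarrow> ord u dvd ord z"
    by (rule exists_element_all_prime_orders[OF Suc.prems(1,2)]) blast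
  then have zc: "z \<in> carrier G" using K.subset by blast
  obtain \<chi> where \<chi>: "\<chi> \<in> hom G complex_units" "\<And>k::nat. \<chi> (z [^] k) = 1 \<Longrightarrow> z [^] k = \<one>"
    using exists_faithful_character[OF zc z(2)] by blast
  interpret \<chi>: group_hom G complex_units \<chi>
    using \<chi>(1) by (simp add: group_hom_def group_hom_axioms_def complex_units.is_group)
  define K' where "K' = {x \<in> K. \<chi> x = 1}"
  have "K' = K \<inter> kernel G complex_units \<chi>"
    using K.subset by (auto simp: K'_def kernel_def)
  then have K': "subgroup K' G"
    using subgroups_Inter_pair[OF Suc.prems(1) \<chi>.subgroup_kernel] by simp
  have fin': "finite K'" using Suc.prems(2) by (simp add: K'_def)
  have small: "card {x \<in> K'. x [^] p = \<one>} \<le> p ^ d" if p: "Factorial_Ring.prime p" for p :: nat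
  proof (cases "\<exists>u\<in>K. ord u = p")
    case True
    then have dvd: "p dvd ord z" using zp p by auto
    define u where "u = z [^] (ord z div p)"
    have p0: "p > 0" using prime_gt_0_nat[OF p] .
    have u: "u \<in> K" "u \<in> carrier G" "u [^] p = \<one>" 
      using z zc powK dvd by (auto simp: u_def nat_pow_pow)
    have ord_u: "ord u = p"
    proof -
      have "ord u = ord z div (ord z div p)" unfolding u_def
        using dvd z zc p0 by (intro ord_pow) (auto simp: div_dvd_iff_mult dvd_div_eq_0_iff)
      then show ?thesis using dvd z p0 by (metis div_div_eq_right div_self dvd_refl mult_1 nat_less_le)
    qed
    \<comment> \<open>\<open>\<chi> u\<close> is a primitive \<open>p\<close>-th root of unity.\<close>
    have \<chi>u: "p dvd j" if "\<chi> u ^ j = 1" for j :: nat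
    proof -
      have "\<chi> (u [^] j) = 1" using that u by (simp add: \<chi>.hom_nat_pow)
      then have "u [^] j = \<one>" using \<chi>(2)[of "ord z div p * j"] zc by (simp add: u_def nat_pow_pow)
      then show ?thesis using pow_eq_id u ord_u by blast
    qed
    have \<chi>u0: "\<chi> u \<noteq> 0" using \<chi>.hom_closed[OF u(2)] by simp
    let ?T = "{x \<in> K'. x [^] p = \<one>}"
    have "inj_on (\<lambda>(x, j). x \<otimes> u [^] j) (?T \<times> {..<p})"
    proof (rule inj_onI)
      fix a b
      assume ab: "a \<in> ?T \<times> {..<p}" "b \<in> ?T \<times> {..<p}"
        "(case a of (x, j) \<Rightarrow> x \<otimes> u [^] j) = (case b of (x, j) \<Rightarrow> x \<otimes> u [^] j)"
      obtain x i y j where [simp]: "a = (x, i)" "b = (y, j)" by (metis surj_pair)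
      have *: "x \<in> K'" "y \<in> K'" "i \<in> {..<p}" "j \<in> {..<p}" "x \<otimes> u [^] i = y \<otimes> u [^] j"
        using ab by auto
      have c: "x \<in> carrier G" "y \<in> carrier G" using * K.subset by (auto simp: K'_def)
      have "\<chi> (x \<otimes> u [^] i) = \<chi> u ^ i" "\<chi> (y \<otimes> u [^] j) = \<chi> u ^ j"
        using *(1,2) u c by (simp_all add: K'_def \<chi>.hom_nat_pow)
      then have eq: "\<chi> u ^ i = \<chi> u ^ j" using *(5) by metis
      have aux: "b = a" if "a \<le> b" "b < p" "\<chi> u ^ a = \<chi> u ^ b" for a b
      proof -
        have "\<chi> u ^ (b - a) = 1" using that \<chi>u0 by (simp add: power_diff)
        then show ?thesis using \<chi>u[of "b - a"] that nat_dvd_not_less[of "b - a" p] by linarith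
      qed
      have "i = j"
        using aux[OF _ _ eq] aux[OF _ _ eq[symmetric]] *(3,4) by (metis lessThan_iff nat_le_linear)
      then show "a = b" using *(5) c u(2) by simp
    qed
    moreover have "(\<lambda>(x, j). x \<otimes> u [^] j) ` (?T \<times> {..<p}) \<subseteq> {x \<in> K. x [^] p = \<one>}"
    proof clarify
      fix x and j :: nat assume *: "x \<in> K'" "x [^] p = \<one>"
      have "(u [^] j) [^] p = \<one>" using u by (metis nat_pow_pow mult.commute nat_pow_one)
      then show "x \<otimes> u [^] j \<in> K \<and> (x \<otimes> u [^] j) [^] p = \<one>"
        using * u K.subset powK[OF u(1), of j] by (auto simp: K'_def nat_pow_distrib)
    qed
    ultimately have "card (?T \<times> {..<p}) \<le> card {x \<in> K. x [^] p = \<one>}"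
      using Suc.prems(2) by (intro card_inj_on_le[of "\<lambda>(x, j). x \<otimes> u [^] j"]) auto
    also have "\<dots> \<le> p ^ Suc d" by (rule Suc.prems(3)[OF p])
    finally show ?thesis using p0 by (simp add: card_cartesian_product mult.commute)
  next
    case False
    have "x = \<one>" if "x \<in> K'" "x [^] p = \<one>" for x
    proof -
      have x: "x \<in> K" "x \<in> carrier G" using that K.subset by (auto simp: K'_def)
      then have "ord x dvd p" "ord x \<noteq> p" using that False pow_eq_id by auto
      then show ?thesis using p ord_eq_1[OF x(2)] by (auto simp: prime_nat_iff)
    qed
    then have "{x \<in> K'. x [^] p = \<one>} \<subseteq> {\<one>}" by blast
    then have "card {x \<in> K'. x [^] p = \<one>} \<le> card {\<one>}" by (intro card_mono) auto
    also have "\<dots> \<le> p ^ d" using prime_gt_0_nat[OF p] by simp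
    finally show ?thesis .
  qed
  obtain \<psi> where \<psi>: "\<forall>i<d. \<psi> i \<in> hom G complex_units"
    "\<forall>x\<in>K'. (\<forall>i<d. \<psi> i x = 1) \<longrightarrow> x = \<one>"
    using Suc.IH[OF K' fin' small] by blast
  show ?case
  proof (intro exI conjI allI ballI impI)
    let ?\<phi> = "\<lambda>i. case i of 0 \<Rightarrow> \<chi> | Suc j \<Rightarrow> \<psi> j"
    show "?\<phi> i \<in> hom G complex_units" if "i < Suc d" for i
      using that \<psi>(1) \<chi>(1) by (cases i) auto
    show "x = \<one>" if x: "x \<in> K" "\<forall>i<Suc d. ?\<phi> i x = 1" for x
    proof -
      have "\<chi> x = 1" "\<forall>i<d. \<psi> i x = 1" using x(2) by force+
      then show ?thesis using x(1) \<psi>(2) by (auto simp: K'_def)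
    qed
  qed
qed

section \<open>Central subgroups of finite index\<close>

locale central_subgroup = group G + subgroup A G for A and G (structure) +
  assumes central: "\<lbrakk>a \<in> A; g \<in> carrier G\<rbrakk> \<Longrightarrow> a \<otimes> g = g \<otimes> a"
begin

lemma comm_group_central: "comm_group (G\<lparr>carrier := A\<rparr>)"
  by (rule group.group_comm_groupI) (auto simp: subgroup_is_group central)

text \<open>
  The transfer of \<open>\<chi>\<close>.  For a transversal \<open>\<tau>\<close>, the element
  \<open>\<tau> C \<otimes> g \<otimes> inv \<tau> (C #> g)\<close> of \<open>A\<close> measures the failure of
  \<open>\<tau>\<close> to commute with right multiplication by \<open>g\<close>.  These elements satisfy a cocycle
  identity, so the product of their \<open>\<chi>\<close>-values over all cosets \<open>C\<close> is multiplicative in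
  \<open>g\<close>.  If \<open>g\<close> lies in \<open>A\<close>, centrality makes each of them equal to
  \<open>g\<close>.
\<close>
lemma transfer_character:
  assumes fin: "finite (rcosets A)" and chi: "\<chi> \<in> hom (G\<lparr>carrier := A\<rparr>) complex_units"
  obtains T where "T \<in> hom G complex_units" "\<And>a. a \<in> A \<Longrightarrow> T a = \<chi> a ^ card (rcosets A)"
proof -
  define \<tau> where "\<tau> C = (SOME x. x \<in> C)" for C :: "'a set"
  have \<tau>: "\<tau> C \<in> C" "\<tau> C \<in> carrier G" "A #> \<tau> C = C" if C0: "C \<in> rcosets A" for C
  proof -
    show C: "\<tau> C \<in> C"
      unfolding \<tau>_def using rcosets_non_empty[OF that] by (simp add: some_in_eq)
    show "\<tau> C \<in> carrier G" using C rcosets_carrier[OF is_group that] by blast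
    obtain x where "x \<in> carrier G" "C = A #> x" using C0 by (auto simp: RCOSETS_def)
    then show "A #> \<tau> C = C" using C repr_independence[OF _ _ subgroup_axioms] by simp
  qed
  have act: "C #> g \<in> rcosets A" if "C \<in> rcosets A" "g \<in> carrier G" for C g
    using that by (auto simp: RCOSETS_def coset_mult_assoc subset)
  have act_act: "C #> g #> h = C #> (g \<otimes> h)" if "C \<in> rcosets A" "g \<in> carrier G" "h \<in> carrier G" for C g h
    using that rcosets_carrier[OF is_group] by (intro coset_mult_assoc) auto
  have act_one: "C #> \<one> = C" if "C \<in> rcosets A" for C
    using that rcosets_carrier[OF is_group] by (intro coset_mult_one) auto
  define \<delta> where "\<delta> g C = \<tau> C \<otimes> g \<otimes> inv \<tau> (C #> g)" for g C
  have \<delta>: "\<delta> g C \<in> A" if "C \<in> rcosets A" "g \<in> carrier G" for g C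
  proof -
    have "A #> (\<tau> C \<otimes> g) = A #> \<tau> (C #> g)"
      using that \<tau> act by (simp add: subset flip: coset_mult_assoc)
    then have "\<tau> C \<otimes> g \<in> A #> \<tau> (C #> g)"
      using that \<tau> rcos_self[OF _ subgroup_axioms, of "\<tau> C \<otimes> g"] by simp
    then show ?thesis
      unfolding \<delta>_def by (rule rcos_module_imp[OF is_group \<tau>(2)[OF act[OF that]]])
  qed
  have \<delta>_mult: "\<delta> (g \<otimes> h) C = \<delta> g C \<otimes> \<delta> h (C #> g)"
    if "C \<in> rcosets A" "g \<in> carrier G" "h \<in> carrier G" for g h C
  proof -
    have c: "\<tau> C \<in> carrier G" "\<tau> (C #> g) \<in> carrier G" "\<tau> (C #> g #> h) \<in> carrier G"
      using that \<tau> act by auto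
    have cancel: "inv t \<otimes> (t \<otimes> y) = y" if "t \<in> carrier G" "y \<in> carrier G" for t y
      using that by (simp flip: m_assoc)
    show ?thesis unfolding \<delta>_def using that c by (simp add: m_assoc act_act cancel)
  qed
  have \<delta>_central: "\<delta> a C = a" if C0: "C \<in> rcosets A" and that: "a \<in> A" for a C
  proof -
    obtain x where x: "x \<in> carrier G" "C = A #> x" using C0 by (auto simp: RCOSETS_def)
    have "C #> a = A #> (a \<otimes> x)"
      by (simp only: x(2) coset_mult_assoc[OF subset x(1) mem_carrier[OF that]] central[OF that x(1)])
    also have "\<dots> = A #> a #> x" by (rule coset_mult_assoc[OF subset mem_carrier[OF that] x(1), symmetric])
    also have "\<dots> = C" by (simp only: coset_join2[OF mem_carrier[OF that] subgroup_axioms that] x(2))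
    finally have "\<delta> a C = a \<otimes> \<tau> C \<otimes> inv \<tau> C" by (simp only: \<delta>_def central[OF that \<tau>(2)[OF C0]])
    then show ?thesis using \<tau>(2)[OF C0] that by (simp add: m_assoc)
  qed
  interpret \<chi>: group_hom "G\<lparr>carrier := A\<rparr>" complex_units \<chi>
    using chi by (simp add: group_hom_def group_hom_axioms_def subgroup_is_group)
  have \<chi>: "\<chi> (a \<otimes> b) = \<chi> a * \<chi> b" "\<chi> a \<noteq> 0" if "a \<in> A" "b \<in> A" for a b
    using that \<chi>.hom_mult[of a b] \<chi>.hom_closed[of a] by auto
  define T where "T g = (\<Prod>C\<in>rcosets A. \<chi> (\<delta> g C))" for g
  show thesis
  proof (rule that[of T])
    show "T \<in> hom G complex_units"
    proof (rule homI)
      fix g assume "g \<in> carrier G"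
      then show "T g \<in> carrier complex_units" using fin \<chi>(2) \<delta> by (auto simp: T_def)
    next
      fix g h assume gh: "g \<in> carrier G" "h \<in> carrier G"
      have bij: "bij_betw (\<lambda>C. C #> g) (rcosets A) (rcosets A)"
        by (rule bij_betw_byWitness[where f' = "\<lambda>C. C #> inv g"])
           (use gh act act_act act_one in auto)
      have "T (g \<otimes> h) = (\<Prod>C\<in>rcosets A. \<chi> (\<delta> g C)) * (\<Prod>C\<in>rcosets A. \<chi> (\<delta> h (C #> g)))"
        unfolding T_def using gh by (simp add: \<delta>_mult \<chi>(1) \<delta> act prod.distrib)
      also have "(\<Prod>C\<in>rcosets A. \<chi> (\<delta> h (C #> g))) = T h"
        unfolding T_def by (rule prod.reindex_bij_betw[OF bij])
      finally show "T (g \<otimes> h) = T g \<otimes>\<^bsub>complex_units\<^esub> T h" by (simp add: T_def)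
    qed
    show "T a = \<chi> a ^ card (rcosets A)" if "a \<in> A" for a
      using that by (simp add: T_def \<delta>_central)
  qed
qed

text \<open>
  In cohomological terms: push the central extension of \<open>G\<close> modulo \<open>A\<close> out along
  \<open>\<phi>\<close> to an extension by the divisible group \<open>D\<close>.  Its class is killed by
  \<open>n\<close>, as the existence of \<open>T\<close> shows, hence comes from an extension \<open>Q\<close> by the
  elements of \<open>D\<close> of exponent dividing \<open>n\<close>.  Enlarging or shrinking an abelian central
  factor does not change the derived subgroup, and injectivity of \<open>\<phi>\<close> on \<open>A\<close> and the
  derived subgroup makes the latter survive the pushout.  The set \<open>P\<close> and the normal subgroup
  \<open>N\<close> below describe \<open>Q = P / N\<close> explicitly.
\<close>
lemma quotient_with_same_derived_subgroup:
  fixes D :: "('d, 'e) monoid_scheme"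
  assumes D: "comm_group D" "\<And>d. d \<in> carrier D \<Longrightarrow> \<exists>e\<in>carrier D. e [^]\<^bsub>D\<^esub> n = d"
    and tors: "finite {d \<in> carrier D. d [^]\<^bsub>D\<^esub> n = \<one>\<^bsub>D\<^esub>}"
    and \<phi>: "\<phi> \<in> hom (G\<lparr>carrier := A\<rparr>) D"
    and inj: "\<And>a. \<lbrakk>a \<in> A; a \<in> derived G (carrier G); \<phi> a = \<one>\<^bsub>D\<^esub>\<rbrakk> \<Longrightarrow> a = \<one>"
    and T: "T \<in> hom G D" "\<And>a. a \<in> A \<Longrightarrow> T a = \<phi> a [^]\<^bsub>D\<^esub> (n::nat)"
    and fin: "finite (rcosets A)"
  obtains Q :: "('a \<times> 'd) set monoid" where
    "group Q" "finite (carrier Q)"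
    "order Q \<le> card (rcosets A) * card {d \<in> carrier D. d [^]\<^bsub>D\<^esub> n = \<one>\<^bsub>D\<^esub>}"
    "G\<lparr>carrier := derived G (carrier G)\<rparr> \<cong> Q\<lparr>carrier := derived Q (carrier Q)\<rparr>"
proof -
  interpret D: comm_group D by fact
  interpret T: group_hom G D T using T(1) by (simp add: group_hom_def group_hom_axioms_def)
  interpret \<phi>: group_hom "G\<lparr>carrier := A\<rparr>" D \<phi>
    using \<phi> by (simp add: group_hom_def group_hom_axioms_def subgroup_is_group)
  let ?E = "G \<times>\<times> D"
  interpret E: group ?E by (intro DirProd_group is_group D.is_group)
  define P where "P = {(g, d). g \<in> carrier G \<and> d \<in> carrier D \<and> d [^]\<^bsub>D\<^esub> n = T g}"
  define N where "N = (\<lambda>a. (a, \<phi> a)) ` A"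
  let ?P = "?E\<lparr>carrier := P\<rparr>"
  have Psub: "subgroup P ?E"
  proof (rule E.subgroupI)
    have "(\<one>, \<one>\<^bsub>D\<^esub>) \<in> P" by (simp add: P_def)
    then show "P \<noteq> {}" by blast
  qed (auto simp: P_def D.nat_pow_distrib D.nat_pow_inv)
  interpret P: group ?P by (rule E.subgroup_imp_group[OF Psub])
  have inA: "\<phi> a \<in> carrier D" "(a, \<phi> a) \<in> P" if "a \<in> A" for a
    using that \<phi>.hom_closed[of a] T(2) by (auto simp: P_def)
  have "group_hom (G\<lparr>carrier := A\<rparr>) ?P (\<lambda>a. (a, \<phi> a))"
    using inA by (auto simp: group_hom_def group_hom_axioms_def subgroup_is_group P.is_group hom_def
        intro: \<phi>.hom_mult[simplified])
  then have Nsub: "subgroup N ?P"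
    unfolding N_def using group_hom.img_is_subgroup by fastforce
  have N: "N \<lhd> ?P"
  proof (rule P.normal_invI[OF Nsub])
    fix x h assume x: "x \<in> carrier ?P" and h: "h \<in> N"
    have c: "x \<otimes>\<^bsub>?P\<^esub> h = h \<otimes>\<^bsub>?P\<^esub> x"
      using x h inA by (auto simp: N_def P_def central D.m_comm)
    have "h \<in> carrier ?P" using h inA by (auto simp: N_def)
    then have "x \<otimes>\<^bsub>?P\<^esub> h \<otimes>\<^bsub>?P\<^esub> inv\<^bsub>?P\<^esub> x = h"
      using x unfolding c by (simp only: P.m_assoc P.inv_closed P.r_inv P.r_one)
    then show "x \<otimes>\<^bsub>?P\<^esub> h \<otimes>\<^bsub>?P\<^esub> inv\<^bsub>?P\<^esub> x \<in> N" using h by simp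
  qed
  interpret N: normal N ?P by (rule N)
  define Q where "Q = ?P Mod N"
  define \<pi> where "\<pi> x = N #>\<^bsub>?P\<^esub> x" for x
  interpret Q: group Q unfolding Q_def by (rule N.factorgroup_is_group)
  have "\<pi> \<in> hom ?P Q" unfolding \<pi>_def Q_def by (rule N.r_coset_hom_Mod)
  then interpret \<pi>: group_hom ?P Q \<pi> by (simp add: group_hom_def group_hom_axioms_def P.is_group Q.is_group)
  have surj: "\<pi> ` P = carrier Q" unfolding \<pi>_def Q_def by (simp add: carrier_FactGroup)
  have ker: "x \<in> N" if "x \<in> P" "\<pi> x = \<one>\<^bsub>Q\<^esub>" for x
    using that P.coset_join1[OF _ _ Nsub, of x] by (simp add: \<pi>_def Q_def)
  have \<pi>N: "\<pi> x = \<one>\<^bsub>Q\<^esub>" if "x \<in> N" for x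
    using that P.coset_join2[OF _ Nsub, of x] subgroup.subset[OF Nsub] by (auto simp: \<pi>_def Q_def)

  let ?tors = "{d \<in> carrier D. d [^]\<^bsub>D\<^esub> n = \<one>\<^bsub>D\<^esub>}"
  define \<tau> where "\<tau> C = (SOME x. x \<in> C)" for C :: "'a set"
  define \<rho> where "\<rho> g = (SOME d. d \<in> carrier D \<and> d [^]\<^bsub>D\<^esub> n = T g)" for g
  have \<rho>: "\<rho> g \<in> carrier D \<and> \<rho> g [^]\<^bsub>D\<^esub> n = T g" if "g \<in> carrier G" for g
    unfolding \<rho>_def by (rule someI_ex) (use D(2)[OF T.hom_closed[OF that]] in blast)
  \<comment> \<open>Modulo \<open>N\<close>, the first component can be moved into a transversal
    \<open>\<tau>\<close>; an \<open>n\<close>-th root \<open>\<rho>\<close> of its \<open>T\<close>-value is then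
    unique up to torsion.\<close>
  have cover: "carrier Q \<subseteq> (\<lambda>(C, t). \<pi> (\<tau> C, \<rho> (\<tau> C) \<otimes>\<^bsub>D\<^esub> t)) ` ((rcosets A) \<times> ?tors)"
  proof
    fix q assume "q \<in> carrier Q"
    then have "q \<in> \<pi> ` P" by (simp only: surj)
    then obtain g d where gd: "(g, d) \<in> P" "q = \<pi> (g, d)" by (metis imageE surj_pair)
    have g: "g \<in> carrier G" "d \<in> carrier D" "d [^]\<^bsub>D\<^esub> n = T g" using gd by (auto simp: P_def)
    let ?C = "A #> g"
    have C: "?C \<in> rcosets A" using g by (simp add: rcosetsI subset)
    have "\<tau> ?C \<in> ?C" unfolding \<tau>_def using rcosets_non_empty[OF C] by (simp add: some_in_eq)
    then obtain a where a: "a \<in> A" "\<tau> ?C = a \<otimes> g" by (auto simp: r_coset_def)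
    have P2: "(a \<otimes> g, \<phi> a \<otimes>\<^bsub>D\<^esub> d) \<in> P" 
      using subgroup.m_closed[OF Psub inA(2)[OF a(1)] gd(1)] by simp
    define t where "t = inv\<^bsub>D\<^esub> \<rho> (\<tau> ?C) \<otimes>\<^bsub>D\<^esub> (\<phi> a \<otimes>\<^bsub>D\<^esub> d)"
    have cl: "\<rho> (\<tau> ?C) \<in> carrier D" "\<rho> (\<tau> ?C) [^]\<^bsub>D\<^esub> n = T (a \<otimes> g)" "\<phi> a \<otimes>\<^bsub>D\<^esub> d \<in> carrier D"
        "(\<phi> a \<otimes>\<^bsub>D\<^esub> d) [^]\<^bsub>D\<^esub> n = T (a \<otimes> g)"
      using \<rho>[of "a \<otimes> g"] a(1) g inA[OF a(1)] P2 unfolding a(2) by (simp_all add: P_def)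
    have t: "t \<in> ?tors"
      unfolding t_def using cl D.l_inv[OF T.hom_closed[of "a \<otimes> g"]] a(1) g(1)
      by (simp add: D.nat_pow_distrib D.nat_pow_inv)
    have "\<rho> (\<tau> ?C) \<otimes>\<^bsub>D\<^esub> t = \<phi> a \<otimes>\<^bsub>D\<^esub> d"
      unfolding t_def using cl(1,3) by (metis D.inv_closed D.m_assoc D.r_inv D.l_one)
    then have "\<pi> (\<tau> ?C, \<rho> (\<tau> ?C) \<otimes>\<^bsub>D\<^esub> t) = \<pi> ((a, \<phi> a) \<otimes>\<^bsub>?P\<^esub> (g, d))" using a by simp
    also have "\<dots> = \<pi> (a, \<phi> a) \<otimes>\<^bsub>Q\<^esub> \<pi> (g, d)" using inA(2)[OF a(1)] gd(1) by (intro \<pi>.hom_mult) simp_all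
    also have "\<dots> = q"
    proof -
      have "\<pi> (a, \<phi> a) = \<one>\<^bsub>Q\<^esub>" using a(1) by (intro \<pi>N) (simp add: N_def)
      then show ?thesis using \<pi>.hom_closed[of "(g, d)"] gd by simp
    qed
    finally show "q \<in> (\<lambda>(C, t). \<pi> (\<tau> C, \<rho> (\<tau> C) \<otimes>\<^bsub>D\<^esub> t)) ` ((rcosets A) \<times> ?tors)"
      using C t by (intro image_eqI[of _ _ "(?C, t)"]) simp_all
  qed
  have fin': "finite ((rcosets A) \<times> ?tors)" using fin tors by simp
  have Qfin: "finite (carrier Q)" by (rule finite_subset[OF cover finite_imageI[OF fin']])
  have Qcard: "order Q \<le> card (rcosets A) * card ?tors"
    using surj_card_le[OF fin' cover] by (simp add: order_def card_cartesian_product)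

  have "fst \<in> hom ?P G" "snd \<in> hom ?P D" by (auto simp: hom_def P_def)
  then have p1: "group_hom ?P G fst" and p2: "group_hom ?P D snd"
    by (simp_all add: group_hom_def group_hom_axioms_def P.is_group D.is_group)
  have fstP: "fst ` P = carrier G"
    using D(2)[OF T.hom_closed] by (force simp: P_def image_iff)
  have der1: "fst ` derived ?P P = derived G (carrier G)"
    using group_hom.derived_img[OF p1, of P] fstP by simp
  \<comment> \<open>Commutators of \<open>P\<close> have trivial second component, as \<open>D\<close> is abelian, and
    every commutator of \<open>G\<close> occurs as first component, as \<open>P\<close> projects onto
    \<open>G\<close>.\<close>
  have "snd ` derived ?P P = derived D (snd ` P)"
    using group_hom.derived_img[OF p2, of P] by simp
  also have "\<dots> = {\<one>\<^bsub>D\<^esub>}" by (rule D.derived_eq_singleton) (auto simp: P_def)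
  finally have der2: "snd x = \<one>\<^bsub>D\<^esub>" if "x \<in> derived ?P P" for x using that by blast
  have derP: "derived ?P P = (\<lambda>g. (g, \<one>\<^bsub>D\<^esub>)) ` derived G (carrier G)"
  proof -
    have "(fst x, \<one>\<^bsub>D\<^esub>) = x" if "x \<in> derived ?P P" for x
      using der2[OF that] by (cases x) simp
    then have "(\<lambda>x. (fst x, \<one>\<^bsub>D\<^esub>)) ` derived ?P P = (\<lambda>x. x) ` derived ?P P"
      by (intro image_cong) simp_all
    then show ?thesis by (simp only: der1[symmetric] image_image image_ident)
  qed
  have derQ: "derived Q (carrier Q) = (\<lambda>g. \<pi> (g, \<one>\<^bsub>D\<^esub>)) ` derived G (carrier G)"
    using \<pi>.derived_img[of P] surj by (simp add: derP image_image)
  let ?G' = "G\<lparr>carrier := derived G (carrier G)\<rparr>" and ?Q' = "Q\<lparr>carrier := derived Q (carrier Q)\<rparr>"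
  have sub: "subgroup (derived G (carrier G)) G" by (simp add: derived_is_subgroup)
  have inP: "(g, \<one>\<^bsub>D\<^esub>) \<in> P" if "g \<in> derived G (carrier G)" for g
  proof -
    have "(g, \<one>\<^bsub>D\<^esub>) \<in> derived ?P P" unfolding derP using that by blast
    then show ?thesis using P.derived_in_carrier[of P] by auto
  qed
  have "(\<lambda>g. \<pi> (g, \<one>\<^bsub>D\<^esub>)) \<in> hom ?G' ?Q'"
  proof (rule homI)
    fix x y assume "x \<in> carrier ?G'" "y \<in> carrier ?G'"
    then show "\<pi> (x \<otimes>\<^bsub>?G'\<^esub> y, \<one>\<^bsub>D\<^esub>) = \<pi> (x, \<one>\<^bsub>D\<^esub>) \<otimes>\<^bsub>?Q'\<^esub> \<pi> (y, \<one>\<^bsub>D\<^esub>)"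
      using inP \<pi>.hom_mult[of "(x, \<one>\<^bsub>D\<^esub>)" "(y, \<one>\<^bsub>D\<^esub>)"] by simp
  qed (simp add: derQ)
  then interpret f: group_hom ?G' ?Q' "\<lambda>g. \<pi> (g, \<one>\<^bsub>D\<^esub>)"
    by (simp add: group_hom_def group_hom_axioms_def subgroup_imp_group[OF sub]
        Q.subgroup_imp_group[OF Q.derived_is_subgroup])
  have "inj_on (\<lambda>g. \<pi> (g, \<one>\<^bsub>D\<^esub>)) (carrier ?G')"
    unfolding f.inj_on_one_iff
  proof (intro allI impI)
    fix x assume x: "x \<in> carrier ?G'" "\<pi> (x, \<one>\<^bsub>D\<^esub>) = \<one>\<^bsub>?Q'\<^esub>"
    then have "(x, \<one>\<^bsub>D\<^esub>) \<in> N" using ker inP by simp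
    then have "x \<in> A" "\<phi> x = \<one>\<^bsub>D\<^esub>" by (auto simp: N_def)
    then show "x = \<one>\<^bsub>?G'\<^esub>" using inj[of x] x(1) by simp
  qed
  then have iso: "(\<lambda>g. \<pi> (g, \<one>\<^bsub>D\<^esub>)) \<in> iso ?G' ?Q'"
    using f.homh derQ by (simp add: iso_def bij_betw_def)
  show thesis by (rule that[OF Q.is_group Qfin Qcard is_isoI[OF iso]])
qed

end

section \<open>A finitely generated integral\<close>

lemma finite_generating_set_contains_minimal:
  assumes "finite S" "generating_set G S"
  obtains T where "T \<subseteq> S" "minimal_generating_set G T"
proof -
  define \<G> where "\<G> = {T. T \<subseteq> S \<and> generating_set G T}"
  have "finite \<G>" "S \<in> \<G>" using assms by (auto simp: \<G>_def)
  then obtain T where T: "T \<in> \<G>" "\<And>U. U \<in> \<G> \<Longrightarrow> U \<subseteq> T \<Longrightarrow> T = U"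
    using finite_has_minimal[of \<G>] by blast
  have "minimal_generating_set G T"
    unfolding minimal_generating_set_def
  proof (intro conjI allI impI notI)
    show "generating_set G T" using T by (simp add: \<G>_def)
    fix U assume "U \<subset> T" "generating_set G U"
    then show False using T(1) T(2)[of U] by (auto simp: \<G>_def)
  qed
  then show thesis using that T by (auto simp: \<G>_def)
qed

lemma card_minimal_generating_set_le:
  assumes "finite (carrier G)" "minimal_generating_set G S"
  shows "card S \<le> max_min_gen G"
proof -
  have "{card S |S. minimal_generating_set G S} \<subseteq> card ` Pow (carrier G)"
    by (auto simp: minimal_generating_set_def generating_set_def)
  then have "finite {card S |S. minimal_generating_set G S}"
    by (rule finite_subset) (use assms in simp)
  then show ?thesis unfolding max_min_gen_def using assms by (intro Max_ge) auto
qed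

lemma is_integral_embedding:
  assumes "group G" "is_integral H G"
  obtains \<iota> where "\<iota> \<in> hom G H" "inj_on \<iota> (carrier G)" "\<iota> ` carrier G = derived H (carrier H)"
proof -
  interpret H: group H using assms by (simp add: is_integral_def)
  have "group (H\<lparr>carrier := derived H (carrier H)\<rparr>)"
    by (rule H.subgroup_imp_group[OF H.derived_is_subgroup]) simp
  then have "G \<cong> H\<lparr>carrier := derived H (carrier H)\<rparr>"
    using assms group.iso_sym unfolding is_integral_def by blast
  then obtain \<iota> where "\<iota> \<in> iso G (H\<lparr>carrier := derived H (carrier H)\<rparr>)" by (auto simp: is_iso_def)
  then have "\<iota> \<in> hom G H" "inj_on \<iota> (carrier G)" "\<iota> ` carrier G = derived H (carrier H)"
    using H.derived_in_carrier[of "carrier H"] by (auto simp: iso_def bij_betw_def hom_def)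
  then show thesis by (rule that)
qed

text \<open>
  The commutators of \<open>H\<close> correspond to a generating set of \<open>G\<close>, which contains a minimal one
  \<open>R\<close>.  Take the two entries of one commutator for each element of \<open>R\<close>: the subgroup
  \<open>K\<close> that they generate has these commutators in its derived subgroup, which is therefore all of that of
  \<open>H\<close>.
\<close>
lemma is_integral_few_generators:
  fixes H :: "('h, 'c) monoid_scheme"
  assumes G: "group G" "finite (carrier G)" and int: "is_integral H G"
  obtains K Y where "is_integral (H\<lparr>carrier := K\<rparr>) G" "generating_set (H\<lparr>carrier := K\<rparr>) Y"
    "finite Y" "card Y \<le> 2 * max_min_gen G"
proof -
  interpret G: group G by fact
  interpret H: group H using int by (simp add: is_integral_def)
  obtain \<iota> where \<iota>: "\<iota> \<in> hom G H" "inj_on \<iota> (carrier G)" "\<iota> ` carrier G = derived H (carrier H)"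
    using is_integral_embedding[OF G(1) int] by blast
  interpret \<iota>: group_hom G H \<iota> using \<iota>(1) by (simp add: group_hom_def group_hom_axioms_def)
  define C where "C = derived_set H (carrier H)"
  have CD: "C \<subseteq> derived H (carrier H)" unfolding derived_def C_def by (auto intro: generate.incl)
  define S where "S = {g \<in> carrier G. \<iota> g \<in> C}"
  have S: "S \<subseteq> carrier G" by (auto simp: S_def)
  have SC: "\<iota> ` S = C" using CD unfolding S_def \<iota>(3)[symmetric] by blast
  have "\<iota> ` generate G S = \<iota> ` carrier G"
    using \<iota>.generate_img[OF S] \<iota>(3) by (simp add: derived_def SC C_def)
  then have "generate G S = carrier G"
    using \<iota>(2) G.generate_incl[OF S] by (simp add: inj_on_image_eq_iff)
  then have "generating_set G S" using S by (simp add: generating_set_def)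
  then obtain R where R: "R \<subseteq> S" "minimal_generating_set G R"
    using finite_generating_set_contains_minimal finite_subset[OF S G(2)] by blast
  then have genR: "R \<subseteq> carrier G" "generate G R = carrier G"
    by (auto simp: minimal_generating_set_def generating_set_def)
  have finR: "finite R" using genR(1) G(2) finite_subset by blast
  have "\<forall>g\<in>R. \<exists>x y. x \<in> carrier H \<and> y \<in> carrier H \<and> \<iota> g = x \<otimes>\<^bsub>H\<^esub> y \<otimes>\<^bsub>H\<^esub> inv\<^bsub>H\<^esub> x \<otimes>\<^bsub>H\<^esub> inv\<^bsub>H\<^esub> y"
    using R(1) by (auto simp: S_def C_def)
  then obtain x y where xy: "\<And>g. g \<in> R \<Longrightarrow> x g \<in> carrier H \<and> y g \<in> carrier H \<and>
      \<iota> g = x g \<otimes>\<^bsub>H\<^esub> y g \<otimes>\<^bsub>H\<^esub> inv\<^bsub>H\<^esub> x g \<otimes>\<^bsub>H\<^esub> inv\<^bsub>H\<^esub> y g" by metis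
  define Y where "Y = x ` R \<union> y ` R"
  define K where "K = generate H Y"
  let ?K = "H\<lparr>carrier := K\<rparr>"
  have Y: "Y \<subseteq> carrier H" using xy by (auto simp: Y_def)
  have K: "subgroup K H" unfolding K_def by (rule H.generate_is_subgroup[OF Y])
  have YK: "Y \<subseteq> K" by (auto simp: K_def intro: generate.incl)
  have "\<iota> ` R \<subseteq> derived_set H K"
    using xy YK unfolding Y_def by blast
  then have "generate H (\<iota> ` R) \<subseteq> derived H K" unfolding derived_def by (rule H.mono_generate)
  then have "derived H (carrier H) \<subseteq> derived H K"
    using \<iota>.generate_img[OF genR(1)] genR(2) \<iota>(3) by simp
  moreover have "derived H K \<subseteq> derived H (carrier H)"
    by (rule H.mono_derived[OF subgroup.subset[OF K]])
  ultimately have "derived ?K K = derived H (carrier H)"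
    using H.derived_consistent[OF order_refl K] by simp
  then have "is_integral ?K G"
    using int H.subgroup_imp_group[OF K] by (simp add: is_integral_def)
  moreover have "generating_set ?K Y"
    using H.generate_consistent[OF YK K] YK by (simp add: generating_set_def K_def)
  moreover have "finite Y" using finR by (simp add: Y_def)
  moreover have "card Y \<le> 2 * max_min_gen G"
  proof -
    have "card Y \<le> card (x ` R) + card (y ` R)" unfolding Y_def by (rule card_Un_le)
    also have "\<dots> \<le> card R + card R" by (intro add_mono card_image_le finR)
    also have "\<dots> \<le> 2 * max_min_gen G" using card_minimal_generating_set_le[OF G(2) R(2)] by simp
    finally show ?thesis .
  qed
  ultimately show thesis by (rule that)
qed

section \<open>The index of the centre\<close>

lemma finite_auto:
  assumes "finite (carrier G)"
  shows "finite (auto G)"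
proof (rule finite_subset)
  show "auto G \<subseteq> carrier G \<rightarrow>\<^sub>E carrier G" by (auto simp: auto_def hom_def Bij_def PiE_def)
  show "finite (carrier G \<rightarrow>\<^sub>E carrier G)" using assms by (simp add: finite_PiE)
qed

lemma (in group) central_if_commutes_with_generators:
  assumes Y: "generating_set G Y" and e: "e \<in> carrier G"
    and comm: "\<And>y. y \<in> Y \<Longrightarrow> e \<otimes> y = y \<otimes> e"
  shows "e \<in> carrier (group_center G)"
proof -
  let ?C = "{g \<in> carrier G. e \<otimes> g = g \<otimes> e}"
  have "subgroup ?C G"
  proof (rule subgroupI)
    show "?C \<noteq> {}" using e by auto
    show "inv a \<in> ?C" if "a \<in> ?C" for a
    proof -
      have a: "a \<in> carrier G" "e \<otimes> a = a \<otimes> e" using that by auto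
      have "e \<otimes> inv a = inv a \<otimes> (a \<otimes> e) \<otimes> inv a" using a(1) e by (simp flip: m_assoc)
      also have "\<dots> = inv a \<otimes> e" unfolding a(2)[symmetric] using a(1) e by (simp add: m_assoc)
      finally show ?thesis using a by simp
    qed
    show "a \<otimes> b \<in> ?C" if "a \<in> ?C" "b \<in> ?C" for a b
      using that e by simp (metis m_assoc)
  qed auto
  then have "generate G Y \<subseteq> ?C"
    using Y comm by (intro generate_subgroup_incl) (auto simp: generating_set_def)
  then show ?thesis using Y e by (auto simp: group_center_def generating_set_def)
qed

lemma (in group) central_subgroup_center: "central_subgroup (carrier (group_center G)) G"
proof -
  let ?C = "{z \<in> carrier G. \<forall>g\<in>carrier G. z \<otimes> g = g \<otimes> z}"
  have "subgroup ?C G"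
  proof (rule subgroupI)
    show "?C \<noteq> {}" by (auto intro!: exI[of _ \<one>])
    show "inv a \<in> ?C" if "a \<in> ?C" for a
    proof -
      have a: "a \<in> carrier G" "\<And>g. g \<in> carrier G \<Longrightarrow> a \<otimes> g = g \<otimes> a" using that by auto
      have "inv a \<otimes> g = g \<otimes> inv a" if g: "g \<in> carrier G" for g
      proof -
        have "inv a \<otimes> g = inv a \<otimes> (g \<otimes> a) \<otimes> inv a" using a(1) g by (simp add: m_assoc)
        also have "\<dots> = g \<otimes> inv a" unfolding a(2)[OF g, symmetric] using a(1) g by (simp flip: m_assoc)
        finally show ?thesis .
      qed
      then show ?thesis using a by simp
    qed
    show "a \<otimes> b \<in> ?C" if "a \<in> ?C" "b \<in> ?C" for a b
    proof -
      have ab: "a \<in> carrier G" "b \<in> carrier G"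
        "\<And>g. g \<in> carrier G \<Longrightarrow> a \<otimes> g = g \<otimes> a" "\<And>g. g \<in> carrier G \<Longrightarrow> b \<otimes> g = g \<otimes> b"
        using that by auto
      have "a \<otimes> b \<otimes> g = g \<otimes> (a \<otimes> b)" if g: "g \<in> carrier G" for g
      proof -
        have "a \<otimes> b \<otimes> g = a \<otimes> (g \<otimes> b)" using ab(1,2) g by (simp only: m_assoc ab(4)[OF g])
        also have "\<dots> = g \<otimes> a \<otimes> b" using ab(1,2) g by (simp only: ab(3)[OF g] flip: m_assoc)
        finally show ?thesis using ab(1,2) g by (simp only: m_assoc)
      qed
      then show ?thesis using ab(1,2) by simp
    qed
  qed auto
  then show ?thesis
    by (auto simp: central_subgroup_def central_subgroup_axioms_def group_center_def is_group)
qed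

text \<open>
  To each \<open>h\<close> attach the automorphism \<open>\<alpha> h\<close> that conjugation by \<open>h\<close>
  induces on the derived subgroup (transported to \<open>G0\<close> along \<open>\<iota>\<close>).  Dividing
  \<open>h\<close> by a fixed representative \<open>r (\<alpha> h)\<close> of this automorphism leaves an element
  \<open>c h\<close> that centralizes the derived subgroup.  For each generator \<open>x\<close> the commutator
  \<open>[x, c h]\<close> is then central in the derived subgroup, because
  \<open>x \<otimes> c h \<otimes> inv x\<close> and \<open>c h\<close> both centralize it.  The pair
  \<open>F h\<close> of \<open>\<alpha> h\<close> and the family of these commutators determines the coset of
  \<open>h\<close> modulo the centre: if \<open>h\<close> and \<open>h'\<close> give the same pair, then
  \<open>inv h' \<otimes> h\<close> commutes with every generator.
\<close>
lemma (in group) index_center_le: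
  fixes G0 :: "('g, 'k) monoid_scheme"
  assumes Y: "generating_set G Y" "finite Y"
    and G0: "group G0" "finite (carrier G0)"
    and \<iota>: "\<iota> \<in> hom G0 G" "inj_on \<iota> (carrier G0)" "\<iota> ` carrier G0 = derived G (carrier G)"
  shows "finite (rcosets carrier (group_center G))"
    and "card (rcosets carrier (group_center G)) \<le> order (AutoGroup G0) * order (group_center G0) ^ card Y"
proof -
  let ?A = "carrier (group_center G)" and ?D = "derived G (carrier G)"
  interpret A: central_subgroup ?A G by (rule central_subgroup_center)
  interpret G0: group G0 by fact
  interpret \<iota>: group_hom G0 G \<iota> using \<iota>(1) by (simp add: group_hom_def group_hom_axioms_def)
  interpret D: normal ?D G by (rule derived_self_is_normal)
  define \<kappa> where "\<kappa> = inv_into (carrier G0) \<iota>"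
  have \<kappa>: "\<kappa> y \<in> carrier G0" "\<iota> (\<kappa> y) = y" if "y \<in> ?D" for y
    using that unfolding \<kappa>_def \<iota>(3)[symmetric] by (auto intro: inv_into_into f_inv_into_f)
  have \<iota>D: "\<iota> g \<in> ?D" if "g \<in> carrier G0" for g using that \<iota>(3) by blast
  have \<kappa>_inj: "y = z" if "y \<in> ?D" "z \<in> ?D" "\<kappa> y = \<kappa> z" for y z
    using \<kappa>(2)[OF that(1)] \<kappa>(2)[OF that(2)] that(3) by metis
  have \<iota>_eqI: "g = g'" if "g \<in> carrier G0" "g' \<in> carrier G0" "\<iota> g = \<iota> g'" for g g'
    using \<iota>(2) that by (auto dest: inj_onD)
  have conjD: "h \<otimes> y \<otimes> inv h \<in> ?D" if "h \<in> carrier G" "y \<in> ?D" for h y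
    using that by (rule D.inv_op_closed2)
  have cancel: "inv t \<otimes> (t \<otimes> y) = y" "t \<otimes> (inv t \<otimes> y) = y" if "t \<in> carrier G" "y \<in> carrier G" for t y
    using that by (simp_all flip: m_assoc)
  define \<alpha> where "\<alpha> h = (\<lambda>g\<in>carrier G0. \<kappa> (h \<otimes> \<iota> g \<otimes> inv h))" for h
  have \<iota>\<alpha>: "\<iota> (\<alpha> h g) = h \<otimes> \<iota> g \<otimes> inv h" "\<alpha> h g \<in> carrier G0" if "h \<in> carrier G" "g \<in> carrier G0" for h g
    using that \<kappa>[OF conjD[OF that(1) \<iota>D[OF that(2)]]] by (simp_all add: \<alpha>_def)
  have \<alpha>_auto: "\<alpha> h \<in> auto G0" if h: "h \<in> carrier G" for h
  proof -
    have "\<alpha> h \<in> hom G0 G0"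
    proof (rule homI)
      fix g g' assume g: "g \<in> carrier G0" "g' \<in> carrier G0"
      show "\<alpha> h (g \<otimes>\<^bsub>G0\<^esub> g') = \<alpha> h g \<otimes>\<^bsub>G0\<^esub> \<alpha> h g'"
        by (rule \<iota>_eqI) (use h g in \<open>simp_all add: \<iota>\<alpha> m_assoc cancel\<close>)
    qed (use \<iota>\<alpha> h in auto)
    moreover have inj: "inj_on (\<alpha> h) (carrier G0)"
    proof (rule inj_onI)
      fix g g' assume g: "g \<in> carrier G0" "g' \<in> carrier G0" "\<alpha> h g = \<alpha> h g'"
      then have "h \<otimes> \<iota> g \<otimes> inv h = h \<otimes> \<iota> g' \<otimes> inv h" using \<iota>\<alpha>(1)[OF h] by metis
      then show "g = g'" using h g by (intro \<iota>_eqI) simp_all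
    qed
    moreover have "\<alpha> h ` carrier G0 = carrier G0"
      by (rule endo_inj_surj[OF G0(2) _ inj]) (use \<iota>\<alpha> h in auto)
    ultimately show ?thesis by (simp add: auto_def Bij_def bij_betw_def \<alpha>_def)
  qed

  define r where "r a = (SOME h. h \<in> carrier G \<and> \<alpha> h = a)" for a
  define c where "c h = inv (r (\<alpha> h)) \<otimes> h" for h
  have r: "r (\<alpha> h) \<in> carrier G \<and> \<alpha> (r (\<alpha> h)) = \<alpha> h" if "h \<in> carrier G" for h
    unfolding r_def by (rule someI_ex) (use that in blast)
  have c: "c h \<in> carrier G" if "h \<in> carrier G" for h using r[OF that] that by (simp add: c_def)
  have c_comm: "c h \<otimes> y = y \<otimes> c h" if h: "h \<in> carrier G" and y: "y \<in> ?D" for h y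
  proof -
    let ?r = "r (\<alpha> h)"
    obtain g where g: "g \<in> carrier G0" "y = \<iota> g" using y \<iota>(3) by blast
    have y': "y \<in> carrier G" using y D.subset by blast
    have rc: "?r \<in> carrier G" using r[OF h] by blast
    have "?r \<otimes> y \<otimes> inv ?r = h \<otimes> y \<otimes> inv h"
      using \<iota>\<alpha>(1)[OF rc g(1)] \<iota>\<alpha>(1)[OF h g(1)] r[OF h] g(2) by simp
    then have "inv ?r \<otimes> (?r \<otimes> y \<otimes> inv ?r) \<otimes> h = inv ?r \<otimes> (h \<otimes> y \<otimes> inv h) \<otimes> h" by simp
    then have "y \<otimes> (inv ?r \<otimes> h) = (inv ?r \<otimes> h) \<otimes> y"
      using h y' rc by (simp add: m_assoc cancel)
    then show ?thesis by (simp add: c_def)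
  qed
  have commD: "x \<otimes> c h \<otimes> inv x \<otimes> inv (c h) \<in> ?D" if "x \<in> carrier G" "h \<in> carrier G" for x h
    unfolding derived_def using that c by (intro generate.incl) blast
  let ?Z = "carrier (group_center G0)"
  have \<kappa>_comm: "\<kappa> (x \<otimes> c h \<otimes> inv x \<otimes> inv (c h)) \<in> ?Z" if x: "x \<in> carrier G" and h: "h \<in> carrier G" for x h
  proof -
    let ?k = "x \<otimes> c h \<otimes> inv x \<otimes> inv (c h)"
    have "?k \<otimes> y = y \<otimes> ?k" if y: "y \<in> ?D" for y
    proof -
      have y': "y \<in> carrier G" using y D.subset by blast
      have "c h \<otimes> (inv x \<otimes> y \<otimes> x) = (inv x \<otimes> y \<otimes> x) \<otimes> c h"
        by (rule c_comm[OF h D.inv_op_closed1[OF x y]])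
      then have "x \<otimes> (c h \<otimes> (inv x \<otimes> y \<otimes> x)) \<otimes> inv x = x \<otimes> ((inv x \<otimes> y \<otimes> x) \<otimes> c h) \<otimes> inv x" by simp
      then have 1: "x \<otimes> (c h \<otimes> (inv x \<otimes> y)) = y \<otimes> (x \<otimes> (c h \<otimes> inv x))"
        using x c[OF h] y' by (simp add: m_assoc cancel)
      have "inv (c h) \<otimes> (c h \<otimes> y) \<otimes> inv (c h) = inv (c h) \<otimes> (y \<otimes> c h) \<otimes> inv (c h)"
        by (simp only: c_comm[OF h y])
      then have 2: "inv (c h) \<otimes> y = y \<otimes> inv (c h)" using c[OF h] y' by (simp add: m_assoc cancel)
      have "?k \<otimes> y = x \<otimes> (c h \<otimes> (inv x \<otimes> y)) \<otimes> inv (c h)"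
        using x c[OF h] y' by (simp add: m_assoc 2)
      also have "\<dots> = y \<otimes> ?k" unfolding 1 using x c[OF h] y' by (simp add: m_assoc)
      finally show ?thesis .
    qed
    then have "\<kappa> ?k \<otimes>\<^bsub>G0\<^esub> g = g \<otimes>\<^bsub>G0\<^esub> \<kappa> ?k" if g: "g \<in> carrier G0" for g
      using g \<iota>D[OF g] \<kappa>[OF commD[OF x h]] by (intro \<iota>_eqI) simp_all
    then show ?thesis using \<kappa>(1)[OF commD[OF x h]] by (simp add: group_center_def)
  qed

  define F where "F h = (\<alpha> h, \<lambda>x\<in>Y. \<kappa> (x \<otimes> c h \<otimes> inv x \<otimes> inv (c h)))" for h
  have Yc: "Y \<subseteq> carrier G" using Y by (simp add: generating_set_def)
  let ?M = "auto G0 \<times> (Y \<rightarrow>\<^sub>E ?Z)"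
  have F: "F h \<in> ?M" if "h \<in> carrier G" for h
    using that \<alpha>_auto \<kappa>_comm Yc by (auto simp: F_def)
  have F_eq: "h \<otimes> inv h' \<in> ?A" if h: "h \<in> carrier G" "h' \<in> carrier G" and eq: "F h = F h'" for h h'
  proof -
    have \<alpha>: "\<alpha> h = \<alpha> h'" using eq by (simp add: F_def)
    have rc: "r (\<alpha> h) \<in> carrier G" using r[OF h(1)] by blast
    define e where "e = inv (c h') \<otimes> c h"
    have e: "e = inv h' \<otimes> h" "e \<in> carrier G"
      using h rc by (simp_all add: e_def c_def \<alpha> inv_mult_group m_assoc cancel)
    have "e \<otimes> x = x \<otimes> e" if x: "x \<in> Y" for x
    proof -
      have xc: "x \<in> carrier G" using x Yc by blast
      have "\<kappa> (x \<otimes> c h \<otimes> inv x \<otimes> inv (c h)) = \<kappa> (x \<otimes> c h' \<otimes> inv x \<otimes> inv (c h'))"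
        using eq x unfolding F_def by (metis (no_types, lifting) prod.inject restrict_apply')
      then have "x \<otimes> c h \<otimes> inv x \<otimes> inv (c h) = x \<otimes> c h' \<otimes> inv x \<otimes> inv (c h')"
        by (rule \<kappa>_inj[OF commD[OF xc h(1)] commD[OF xc h(2)]])
      then have "c h \<otimes> inv x \<otimes> inv (c h) = c h' \<otimes> inv x \<otimes> inv (c h')"
        using xc c h by (simp add: m_assoc)
      then have "inv (c h') \<otimes> (c h \<otimes> inv x \<otimes> inv (c h)) \<otimes> c h = inv (c h') \<otimes> (c h' \<otimes> inv x \<otimes> inv (c h')) \<otimes> c h"
        by simp
      then have 1: "e \<otimes> inv x = inv x \<otimes> e"
        using xc c h by (simp add: m_assoc cancel e_def)
      have "x \<otimes> (e \<otimes> inv x) \<otimes> x = x \<otimes> (inv x \<otimes> e) \<otimes> x" by (simp only: 1)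
      then show ?thesis using xc e(2) by (simp add: m_assoc cancel)
    qed
    then have eA: "e \<in> ?A" by (rule central_if_commutes_with_generators[OF Y(1) e(2)])
    have "h = h' \<otimes> e" using h by (simp add: e(1) cancel)
    also have "\<dots> = e \<otimes> h'" using A.central[OF eA h(2)] by simp
    finally have "h \<otimes> inv h' = e" using h e(2) by (simp add: m_assoc)
    then show ?thesis using eA by simp
  qed

  define \<tau> where "\<tau> C = (SOME x. x \<in> C)" for C :: "'a set"
  have \<tau>: "\<tau> C \<in> carrier G \<and> C = ?A #> \<tau> C" if C: "C \<in> rcosets ?A" for C
  proof -
    have t: "\<tau> C \<in> C"
      unfolding \<tau>_def using A.rcosets_non_empty[OF C] by (simp add: some_in_eq)
    obtain x where x: "x \<in> carrier G" "C = ?A #> x" using C by (auto simp: RCOSETS_def)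
    show ?thesis
      using t x repr_independence[of "\<tau> C" ?A x] A.subgroup_axioms A.rcosets_carrier[OF is_group C] by blast
  qed
  have inj: "inj_on (F \<circ> \<tau>) (rcosets ?A)"
  proof (rule inj_onI)
    fix C C' assume C: "C \<in> rcosets ?A" "C' \<in> rcosets ?A" "(F \<circ> \<tau>) C = (F \<circ> \<tau>) C'"
    have "\<tau> C \<in> ?A #> \<tau> C'"
      using C F_eq[of "\<tau> C" "\<tau> C'"] \<tau> by (intro A.rcos_module_rev[OF is_group]) simp_all
    then have "?A #> \<tau> C' = ?A #> \<tau> C"
      using repr_independence[of "\<tau> C" ?A "\<tau> C'"] \<tau>[OF C(2)] A.subgroup_axioms by blast
    then show "C = C'" using \<tau>[OF C(1)] \<tau>[OF C(2)] by simp
  qed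
  have img: "(F \<circ> \<tau>) ` (rcosets ?A) \<subseteq> ?M"
    by (rule image_subsetI) (simp only: comp_apply F \<tau>)
  have "finite ?Z" using G0(2) by (simp add: group_center_def)
  then have fin: "finite ?M" using finite_auto[OF G0(2)] Y(2) by (intro finite_cartesian_product finite_PiE) auto
  show "finite (rcosets ?A)" using inj img fin by (rule inj_on_finite)
  have "card (rcosets ?A) \<le> card ?M" by (rule card_inj_on_le[OF inj img fin])
  also have "\<dots> = order (AutoGroup G0) * order (group_center G0) ^ card Y"
    using Y(2) by (simp add: card_cartesian_product card_PiE order_def AutoGroup_def)
  finally show "card (rcosets ?A) \<le> order (AutoGroup G0) * order (group_center G0) ^ card Y" .
qed

section \<open>The small integral\<close>

lemma is_integral_transport_nat:
  fixes Q :: "('q, 'r) monoid_scheme" and G :: "('a, 'b) monoid_scheme"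
  assumes "is_integral Q G" "finite (carrier Q)"
  obtains R :: "nat monoid" where "is_integral R G" "finite (carrier R)" "order R = order Q"
proof -
  interpret Q: group Q using assms by (simp add: is_integral_def)
  obtain f :: "'q \<Rightarrow> nat" where f: "inj_on f (carrier Q)"
    using finite_imp_inj_to_nat_seg[OF assms(2)] by blast
  define R where "R = image_group f Q"
  have iso: "f \<in> iso Q R" unfolding R_def by (rule inj_imp_image_group_iso[OF f])
  have "group R" unfolding R_def by (rule Q.inj_imp_image_group_is_group[OF f])
  then interpret f: group_hom Q R f
    using iso by (simp add: group_hom_def group_hom_axioms_def iso_def Q.is_group)
  let ?Q' = "Q\<lparr>carrier := derived Q (carrier Q)\<rparr>" and ?R' = "R\<lparr>carrier := derived R (carrier R)\<rparr>"
  have "f ` derived Q (carrier Q) = derived R (carrier R)"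
    using f.derived_img[of "carrier Q"] iso by (simp add: iso_def bij_betw_def)
  then have "?Q' \<cong> ?R'"
    using is_isoI[OF iso_restrict[OF iso Q.is_group f.H.is_group Q.derived_is_subgroup[of "carrier Q"]]] by simp
  moreover have "group ?Q'" by (rule Q.subgroup_imp_group[OF Q.derived_is_subgroup]) simp
  ultimately have "is_integral R G"
    using assms(1) group.iso_sym iso_trans f.H.is_group unfolding is_integral_def by blast
  moreover have "finite (carrier R)" "order R = order Q"
    using iso_same_card[OF is_isoI[OF iso]] iso_finite[OF is_isoI[OF iso]] assms(2) by (simp_all add: order_def)
  ultimately show thesis using that by blast
qed

lemma min_num_gen_attained:
  assumes "group A" "finite (carrier A)"
  obtains S where "generating_set A S" "card S = min_num_gen A"
proof -
  have "generate A (carrier A) = carrier A"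
    using group.generate_incl[OF assms(1) order_refl] by (auto intro: generate.incl)
  then have "\<exists>n S. finite S \<and> card S = n \<and> generating_set A S"
    using assms(2) by (auto simp: generating_set_def)
  then have "\<exists>S. finite S \<and> card S = min_num_gen A \<and> generating_set A S"
    unfolding min_num_gen_def by (rule LeastI_ex)
  then show thesis using that by blast
qed

lemma group_center_pow: "z [^]\<^bsub>group_center G\<^esub> (k::nat) = z [^]\<^bsub>G\<^esub> k"
  by (simp add: group_center_def nat_pow_def)

lemma group_center_one: "\<one>\<^bsub>group_center G\<^esub> = \<one>\<^bsub>G\<^esub>"
  by (simp add: group_center_def)

lemma group_center_eq: "group_center G = G\<lparr>carrier := carrier (group_center G)\<rparr>"
  by (simp add: group_center_def)

lemma (in group) comm_group_center: "comm_group (group_center G)"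
proof -
  interpret A: central_subgroup "carrier (group_center G)" G by (rule central_subgroup_center)
  show ?thesis using A.comm_group_central by (simp only: group_center_eq[symmetric])
qed

lemma (in group) card_center_torsion_le:
  assumes "finite (carrier G)" "p > 0"
  shows "card {z \<in> carrier (group_center G). z [^] (p::nat) = \<one>} \<le> p ^ min_num_gen (group_center G)"
proof -
  interpret Z: comm_group "group_center G" by (rule comm_group_center)
  have fin: "finite (carrier (group_center G))" using assms by (simp add: group_center_def)
  obtain S where "generating_set (group_center G) S" "card S = min_num_gen (group_center G)"
    using min_num_gen_attained[OF Z.is_group fin] by blast
  then show ?thesis
    using Z.card_torsion_le[OF fin _ assms(2), of S] by (simp add: group_center_pow group_center_one)
qed

lemma product_complex_units:
  fixes d :: nat
  defines "D \<equiv> product_group {..<d} (\<lambda>_. complex_units)"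
  shows "comm_group D"
    and "f \<in> carrier D \<Longrightarrow> f [^]\<^bsub>D\<^esub> (n::nat) = (\<lambda>i\<in>{..<d}. f i ^ n)"
    and "\<lbrakk>n > 0; f \<in> carrier D\<rbrakk> \<Longrightarrow> \<exists>e\<in>carrier D. e [^]\<^bsub>D\<^esub> n = f"
    and "n > 0 \<Longrightarrow> finite {f \<in> carrier D. f [^]\<^bsub>D\<^esub> n = \<one>\<^bsub>D\<^esub>}"
    and "n > 0 \<Longrightarrow> card {f \<in> carrier D. f [^]\<^bsub>D\<^esub> n = \<one>\<^bsub>D\<^esub>} = n ^ d"
proof -
  show comm: "comm_group D"
    by (rule group.group_comm_groupI)
       (auto simp: D_def complex_units.is_group mult.commute intro!: restrict_ext)
  then interpret D: comm_group D .
  have carrier: "carrier D = {..<d} \<rightarrow>\<^sub>E (UNIV - {0})" by (simp add: D_def)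
  show pow: "f [^]\<^bsub>D\<^esub> n = (\<lambda>i\<in>{..<d}. f i ^ n)" if "f \<in> carrier D" for f and n :: nat
    by (induction n) (auto simp: D_def mult.commute intro!: restrict_ext)
  show "\<exists>e\<in>carrier D. e [^]\<^bsub>D\<^esub> n = f" if "n > 0" "f \<in> carrier D" for n :: nat and f
  proof -
    have "\<forall>i. \<exists>z. i < d \<longrightarrow> z \<noteq> 0 \<and> z ^ n = f i"
    proof
      fix i show "\<exists>z. i < d \<longrightarrow> z \<noteq> 0 \<and> z ^ n = f i"
      proof (cases "i < d")
        case True
        then have "f i \<noteq> 0" using that(2) by (auto simp: carrier)
        then show ?thesis using exists_complex_root[OF _ that(1)] by metis
      qed simp
    qed
    then obtain r where r: "\<And>i. i < d \<Longrightarrow> r i \<noteq> 0 \<and> r i ^ n = f i" by metis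
    define e where "e = restrict r {..<d}"
    have e: "e \<in> carrier D" using r by (auto simp: e_def carrier)
    have "e [^]\<^bsub>D\<^esub> n = f"
    proof
      fix i
      show "(e [^]\<^bsub>D\<^esub> n) i = f i"
        using that(2) r[of i] unfolding pow[OF e] carrier by (cases "i < d") (auto simp: e_def PiE_def extensional_def)
    qed
    then show ?thesis using e by blast
  qed
  have tors: "{f \<in> carrier D. f [^]\<^bsub>D\<^esub> n = \<one>\<^bsub>D\<^esub>} = {..<d} \<rightarrow>\<^sub>E {z. z ^ n = 1}" if "n > 0" for n :: nat
  proof (intro equalityI subsetI)
    fix f assume "f \<in> {f \<in> carrier D. f [^]\<^bsub>D\<^esub> n = \<one>\<^bsub>D\<^esub>}"
    then have fc: "f \<in> carrier D" "f [^]\<^bsub>D\<^esub> n = (\<lambda>i\<in>{..<d}. 1)"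
      by (simp_all add: D_def)
    have f: "f \<in> carrier D" "(\<lambda>i\<in>{..<d}. f i ^ n) = (\<lambda>i\<in>{..<d}. 1)"
      by (rule fc(1)) (use fc(2) in \<open>simp only: pow[OF fc(1)]\<close>)
    have "f i ^ n = 1" if "i < d" for i using fun_cong[OF f(2), of i] that by simp
    then show "f \<in> {..<d} \<rightarrow>\<^sub>E {z. z ^ n = 1}" using f(1) by (auto simp: carrier)
  next
    fix f :: "nat \<Rightarrow> complex" assume f: "f \<in> {..<d} \<rightarrow>\<^sub>E {z. z ^ n = 1}"
    have "f i \<noteq> 0" if "i < d" for i
    proof -
      have "f i ^ n = 1" using f that by auto
      then show ?thesis using \<open>n > 0\<close> by (auto simp: power_0_left)
    qed
    then have fc: "f \<in> carrier D" using f by (auto simp: carrier PiE_iff)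
    have "f [^]\<^bsub>D\<^esub> n = \<one>\<^bsub>D\<^esub>"
      unfolding pow[OF fc] using f by (auto simp: D_def PiE_iff intro!: restrict_ext)
    then show "f \<in> {f \<in> carrier D. f [^]\<^bsub>D\<^esub> n = \<one>\<^bsub>D\<^esub>}" using fc by simp
  qed
  show "finite {f \<in> carrier D. f [^]\<^bsub>D\<^esub> n = \<one>\<^bsub>D\<^esub>}" if "n > 0" for n :: nat
    unfolding tors[OF that] using that by (intro finite_PiE finite_roots_unity) simp_all
  show "card {f \<in> carrier D. f [^]\<^bsub>D\<^esub> n = \<one>\<^bsub>D\<^esub>} = n ^ d" if "n > 0" for n :: nat
    using that by (simp add: tors card_PiE card_roots_unity_eq)
qed

text \<open>
  The intersection of the centre with the derived subgroup embeds in the centre of \<open>G0\<close>.  Passing to a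
  subgroup does not increase the number of elements of exponent dividing a prime, and
  \<open>separating_characters\<close> turns the bound on these numbers into characters.
\<close>
lemma (in group) derived_center_separated:
  fixes G0 :: "('g, 'k) monoid_scheme"
  assumes G0: "group G0" "finite (carrier G0)"
    and \<iota>: "\<iota> \<in> hom G0 G" "inj_on \<iota> (carrier G0)" "\<iota> ` carrier G0 = derived G (carrier G)"
  obtains \<chi> where "\<And>i. i < min_num_gen (group_center G0) \<Longrightarrow> \<chi> i \<in> hom (group_center G) complex_units"
    "\<And>x. \<lbrakk>x \<in> carrier (group_center G); x \<in> derived G (carrier G);
        \<And>i. i < min_num_gen (group_center G0) \<Longrightarrow> \<chi> i x = 1\<rbrakk> \<Longrightarrow> x = \<one>"
proof -
  let ?A = "carrier (group_center G)" and ?D = "derived G (carrier G)"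
  interpret A: central_subgroup ?A G by (rule central_subgroup_center)
  interpret Z: comm_group "group_center G" by (rule comm_group_center)
  interpret G0: group G0 by fact
  interpret \<iota>: group_hom G0 G \<iota> using \<iota>(1) by (simp add: group_hom_def group_hom_axioms_def)
  define K where "K = ?A \<inter> ?D"
  have "subgroup K G"
    unfolding K_def by (rule subgroups_Inter_pair[OF A.subgroup_axioms derived_is_subgroup]) simp
  then have K: "subgroup K (group_center G)"
    by (subst group_center_eq, intro subgroup_incl[OF _ A.subgroup_axioms]) (auto simp: K_def)
  have finK: "finite K" using G0(2) by (auto simp: K_def simp flip: \<iota>(3))
  have small: "card {x \<in> K. x [^]\<^bsub>group_center G\<^esub> p = \<one>\<^bsub>group_center G\<^esub>} \<le> p ^ min_num_gen (group_center G0)"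
    if p: "Factorial_Ring.prime p" for p :: nat
  proof -
    let ?T = "{z \<in> carrier (group_center G0). z [^]\<^bsub>G0\<^esub> p = \<one>\<^bsub>G0\<^esub>}"
    have "{x \<in> K. x [^] p = \<one>} \<subseteq> \<iota> ` ?T"
    proof
      fix x assume "x \<in> {x \<in> K. x [^] p = \<one>}"
      then have x: "x \<in> ?A" "x \<in> ?D" "x [^] p = \<one>" by (auto simp: K_def)
      obtain g where g: "g \<in> carrier G0" "x = \<iota> g" using x(2) by (auto simp flip: \<iota>(3))
      have "g \<otimes>\<^bsub>G0\<^esub> h = h \<otimes>\<^bsub>G0\<^esub> g" if h: "h \<in> carrier G0" for h
      proof -
        have "\<iota> (g \<otimes>\<^bsub>G0\<^esub> h) = \<iota> (h \<otimes>\<^bsub>G0\<^esub> g)"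
          using A.central[OF x(1), of "\<iota> h"] g h by simp
        then show ?thesis using inj_onD[OF \<iota>(2)] g(1) h by blast
      qed
      moreover have "g [^]\<^bsub>G0\<^esub> p = \<one>\<^bsub>G0\<^esub>"
        using x(3) g inj_onD[OF \<iota>(2), of "g [^]\<^bsub>G0\<^esub> p" "\<one>\<^bsub>G0\<^esub>"] by (simp add: \<iota>.hom_nat_pow)
      ultimately show "x \<in> \<iota> ` ?T" using g by (auto simp: group_center_def)
    qed
    moreover have "finite ?T" using G0(2) by (simp add: group_center_def)
    ultimately have "card {x \<in> K. x [^] p = \<one>} \<le> card ?T" using surj_card_le by blast
    also have "\<dots> \<le> p ^ min_num_gen (group_center G0)"
      using prime_gt_0_nat[OF p] by (rule G0.card_center_torsion_le[OF G0(2)])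
    finally show ?thesis by (simp add: group_center_pow group_center_one)
  qed
  obtain \<chi> where "\<forall>i<min_num_gen (group_center G0). \<chi> i \<in> hom (group_center G) complex_units"
    "\<forall>x\<in>K. (\<forall>i<min_num_gen (group_center G0). \<chi> i x = 1) \<longrightarrow> x = \<one>"
    using Z.separating_characters[OF K finK small] unfolding group_center_one by blast
  then show thesis by (intro that) (auto simp: K_def)
qed

text \<open>
  The divisible group is a power of the multiplicative group of the complex numbers, with one factor for each of the
  characters separating the points of the centre inside the derived subgroup.  It has exactly \<open>n ^ d\<close>
  elements of exponent dividing \<open>n\<close>, which gives the exponent \<open>d + 1\<close> of the index
  \<open>n\<close>.
\<close>
lemma (in group) small_quotient_integral:
  fixes G0 :: "('g, 'k) monoid_scheme"
  assumes G0: "group G0" "finite (carrier G0)" and int: "is_integral G G0"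
    and fin: "finite (rcosets carrier (group_center G))"
  obtains Q :: "('a \<times> (nat \<Rightarrow> complex)) set monoid" where "is_integral Q G0" "finite (carrier Q)"
    "order Q \<le> card (rcosets carrier (group_center G)) ^ (min_num_gen (group_center G0) + 1)"
proof -
  let ?A = "carrier (group_center G)"
  interpret A: central_subgroup ?A G by (rule central_subgroup_center)
  define n where "n = card (rcosets ?A)"
  define d where "d = min_num_gen (group_center G0)"
  have n: "n > 0" using fin A.subgroup_in_rcosets[OF is_group] by (auto simp: n_def card_gt_0_iff)
  obtain \<iota> where \<iota>: "\<iota> \<in> hom G0 G" "inj_on \<iota> (carrier G0)" "\<iota> ` carrier G0 = derived G (carrier G)"
    using is_integral_embedding[OF G0(1) int] by blast
  obtain \<chi> where \<chi>: "\<And>i. i < d \<Longrightarrow> \<chi> i \<in> hom (group_center G) complex_units"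
    "\<And>x. \<lbrakk>x \<in> ?A; x \<in> derived G (carrier G); \<And>i. i < d \<Longrightarrow> \<chi> i x = 1\<rbrakk> \<Longrightarrow> x = \<one>"
    unfolding d_def using derived_center_separated[OF G0 \<iota>] by blast
  have \<chi>': "\<chi> i \<in> hom (G\<lparr>carrier := ?A\<rparr>) complex_units" if "i < d" for i
    using \<chi>(1)[OF that] by (subst (asm) group_center_eq)
  have "\<forall>i. \<exists>T. i < d \<longrightarrow> T \<in> hom G complex_units \<and> (\<forall>a\<in>?A. T a = \<chi> i a ^ n)"
    using A.transfer_character[OF fin \<chi>'] unfolding n_def by metis
  then obtain T where T: "\<And>i. i < d \<Longrightarrow> T i \<in> hom G complex_units"
    "\<And>i a. \<lbrakk>i < d; a \<in> ?A\<rbrakk> \<Longrightarrow> T i a = \<chi> i a ^ n" by metis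
  define D where "D = product_group {..<d} (\<lambda>_. complex_units)"
  note D = product_complex_units[where d = d, folded D_def]
  let ?\<phi> = "\<lambda>a. \<lambda>i\<in>{..<d}. \<chi> i a" and ?T = "\<lambda>g. \<lambda>i\<in>{..<d}. T i g"
  have hom_D: "(\<lambda>x. \<lambda>i\<in>{..<d}. f i x) \<in> hom B D" if "\<And>i. i < d \<Longrightarrow> f i \<in> hom B complex_units"
    for f and B :: "('a, 'z) monoid_scheme"
    using that by (auto simp: hom_def D_def PiE_iff Pi_iff intro!: restrict_ext)
  have \<phi>: "?\<phi> \<in> hom (G\<lparr>carrier := ?A\<rparr>) D" by (rule hom_D[OF \<chi>'])
  have T_hom: "?T \<in> hom G D" by (rule hom_D[OF T(1)])
  have inj: "a = \<one>" if "a \<in> ?A" "a \<in> derived G (carrier G)" "?\<phi> a = \<one>\<^bsub>D\<^esub>" for a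
  proof (rule \<chi>(2)[OF that(1,2)])
    fix i assume "i < d"
    then show "\<chi> i a = 1" using fun_cong[OF that(3), of i] by (simp add: D_def)
  qed
  have T_\<phi>: "?T a = ?\<phi> a [^]\<^bsub>D\<^esub> n" if a: "a \<in> ?A" for a
  proof -
    have "?\<phi> a \<in> carrier D" using hom_in_carrier[OF \<phi>, of a] a by simp
    then show ?thesis using a by (auto simp: D(2) T(2) intro!: restrict_ext)
  qed
  obtain Q :: "('a \<times> (nat \<Rightarrow> complex)) set monoid" where Q: "group Q" "finite (carrier Q)"
    "order Q \<le> card (rcosets ?A) * card {f \<in> carrier D. f [^]\<^bsub>D\<^esub> n = \<one>\<^bsub>D\<^esub>}"
    "G\<lparr>carrier := derived G (carrier G)\<rparr> \<cong> Q\<lparr>carrier := derived Q (carrier Q)\<rparr>"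
    using A.quotient_with_same_derived_subgroup[OF D(1) D(3)[OF n] D(4)[OF n] \<phi> inj T_hom T_\<phi> fin] by blast
  have "group (G\<lparr>carrier := derived G (carrier G)\<rparr>)"
    by (rule subgroup_imp_group[OF derived_is_subgroup]) simp
  then have "is_integral Q G0"
    using Q(1,4) int group.iso_sym iso_trans unfolding is_integral_def by blast
  moreover have "order Q \<le> n ^ (d + 1)" using Q(3) D(5)[OF n] by (simp add: n_def)
  ultimately show thesis using that Q(2) by (simp add: n_def d_def)
qed

theorem theorem3p3:
  fixes G :: "('a, 'b) monoid_scheme"
    and H :: "('h, 'c) monoid_scheme"
  assumes "group G"
    and "finite (carrier G)"
    and integrable: "is_integral H G"
  shows "\<exists>Q :: nat monoid.
           is_integral Q G \<and> finite (carrier Q) \<and>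
           order Q \<le>
             (order (AutoGroup G) * order (group_center G) ^ (2 * max_min_gen G))
               ^ (min_num_gen (group_center G) + 1)"
proof -
  obtain K Y where int: "is_integral (H\<lparr>carrier := K\<rparr>) G" and Y: "generating_set (H\<lparr>carrier := K\<rparr>) Y"
    "finite Y" "card Y \<le> 2 * max_min_gen G"
    using is_integral_few_generators[OF assms] by blast
  interpret K: group "H\<lparr>carrier := K\<rparr>" using int by (simp add: is_integral_def)
  let ?A = "carrier (group_center (H\<lparr>carrier := K\<rparr>))"
  obtain \<iota> where \<iota>: "\<iota> \<in> hom G (H\<lparr>carrier := K\<rparr>)" "inj_on \<iota> (carrier G)"
    "\<iota> ` carrier G = derived (H\<lparr>carrier := K\<rparr>) (carrier (H\<lparr>carrier := K\<rparr>))"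
    using is_integral_embedding[OF assms(1) int] by blast
  note index = K.index_center_le[OF Y(1,2) assms(1,2) \<iota>]
  obtain Q :: "('h \<times> (nat \<Rightarrow> complex)) set monoid" where Q: "is_integral Q G" "finite (carrier Q)"
    "order Q \<le> card (rcosets\<^bsub>H\<lparr>carrier := K\<rparr>\<^esub> ?A) ^ (min_num_gen (group_center G) + 1)"
    using K.small_quotient_integral[OF assms(1,2) int index(1)] by blast
  obtain R :: "nat monoid" where R: "is_integral R G" "finite (carrier R)" "order R = order Q"
    using is_integral_transport_nat[OF Q(1,2)] by blast
  have "\<one>\<^bsub>G\<^esub> \<in> carrier (group_center G)" "finite (carrier (group_center G))"
    using assms(1,2) by (auto simp: group_center_def group.is_monoid)
  then have "order (group_center G) > 0" by (auto simp: order_def card_gt_0_iff)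
  then have "order (group_center G) ^ card Y \<le> order (group_center G) ^ (2 * max_min_gen G)"
    using Y(3) by (intro power_increasing) auto
  then have "card (rcosets\<^bsub>H\<lparr>carrier := K\<rparr>\<^esub> ?A)
      \<le> order (AutoGroup G) * order (group_center G) ^ (2 * max_min_gen G)"
    using index(2) by (meson le_trans mult_le_mono2)
  then have "card (rcosets\<^bsub>H\<lparr>carrier := K\<rparr>\<^esub> ?A) ^ (min_num_gen (group_center G) + 1)
      \<le> (order (AutoGroup G) * order (group_center G) ^ (2 * max_min_gen G)) ^ (min_num_gen (group_center G) + 1)"
    by (rule power_mono) (rule le0)
  with Q(3) R(3) have "order R \<le> (order (AutoGroup G) * order (group_center G) ^ (2 * max_min_gen G))
      ^ (min_num_gen (group_center G) + 1)"
    by (simp only: R(3) le_trans[OF Q(3)])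
  then show ?thesis using R(1,2) by blast
qed

end
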